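(* For every positive integer $n$ there exists a randomized algorithm that, for every stack $\pi$ of $n$ unburnt pancakes, produces (using random bits) a sequence of flips transforming $\pi$ into $(1,2,\dots,n)$, such that the average number of flips, where the average is taken both over all $n!$ stacks and over the random bits, is at most \[ \frac{17}{12}n+9 . \]
   Context: A stack of $n$ (unburnt) pancakes is a permutation $\pi\in S_n$, $\pi(i)$ being the size of the $i$-th pancake from the top. An $i$-flip reverses the order of the top $i$ pancakes (a prefix reversal of $\pi$). The stack is sorted when it equals $(1,2,\dots,n)$, i.e. sizes increase from top to bottom. *)

theory Defs
  imports "HOL-Combinatorics.Permutations" "HOL-Probability.Probability"
begin

text \<open>
  A stack of n pancakes is a function \<open>\<pi>\<close> with \<open>\<pi> permutes {1..n}\<close>; \<open>\<pi> j\<close> is the size of the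
  j-th pancake from the top.  Since such a function is the identity outside \<open>{1..n}\<close>, the stack
  is \<open>(1, 2, \<dots>, n)\<close> iff \<open>\<pi> = id\<close>.
\<close>

definition flip :: "nat \<Rightarrow> (nat \<Rightarrow> nat) \<Rightarrow> (nat \<Rightarrow> nat)" where
  "flip i \<pi> = (\<lambda>j. if j \<in> {1..i} then \<pi> (i + 1 - j) else \<pi> j)"

text \<open>The head of the list is the flip performed first.\<close>

definition apply_flips :: "nat list \<Rightarrow> (nat \<Rightarrow> nat) \<Rightarrow> (nat \<Rightarrow> nat)" where
  "apply_flips is \<pi> = fold flip is \<pi>"

definition sorts_stack :: "nat \<Rightarrow> nat list \<Rightarrow> (nat \<Rightarrow> nat) \<Rightarrow> bool" where
  "sorts_stack n is \<pi> \<longleftrightarrow> set is \<subseteq> {1..n} \<and> apply_flips is \<pi> = id"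

text \<open>An infinite sequence of independent fair random bits.\<close>

definition random_bits :: "(nat \<Rightarrow> bool) measure" where
  "random_bits = (\<Pi>\<^sub>M k\<in>UNIV. measure_pmf (bernoulli_pmf (1/2)))"

text \<open>
  A randomized algorithm is a function of the input stack and of the random bits.
  Measurability makes the number of flips on each input a random variable.
\<close>

definition randomized_pancake_sort ::
  "nat \<Rightarrow> ((nat \<Rightarrow> nat) \<Rightarrow> (nat \<Rightarrow> bool) \<Rightarrow> nat list) \<Rightarrow> bool" where
  "randomized_pancake_sort n A \<longleftrightarrow>
     (\<forall>\<pi>. \<pi> permutes {1..n} \<longrightarrow>
        A \<pi> \<in> random_bits \<rightarrow>\<^sub>M count_space UNIV \<and>
        (\<forall>\<omega>. sorts_stack n (A \<pi> \<omega>) \<pi>))"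

text \<open>
  The inner expectation is a nonnegative integral, so it is infinite (and not 0 by convention)
  when the number of flips is not integrable.
\<close>

definition average_flips ::
  "nat \<Rightarrow> ((nat \<Rightarrow> nat) \<Rightarrow> (nat \<Rightarrow> bool) \<Rightarrow> nat list) \<Rightarrow> ennreal" where
  "average_flips n A =
     (\<Sum>\<pi> | \<pi> permutes {1..n}. \<integral>\<^sup>+ \<omega>. of_nat (length (A \<pi> \<omega>)) \<partial>random_bits) / of_nat (fact n)"

end

theory Submission
  imports Defs "HOL-Combinatorics.Multiset_Permutations"
begin

text \<open>
  The flips chosen below depend only on the stack, so no random bits are used and it suffices to
  bound the average of the flip distance.

  Sizes are read cyclically. Blocks of pancakes that are already in their final relative order are
  glued together, and at every stage the arrangement of the blocks, together with their
  orientations, stays uniformly distributed. The top block is joined to a neighbour in the cyclic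
  order of sizes. Joining two single pancakes takes one flip; joining a block and a single pancake
  takes \<open>3/2\<close> flips on average; joining two blocks takes \<open>7/4\<close> flips on average, by inspecting the
  orientations of both neighbours of the top block before choosing one of them. Gluing all \<open>n\<close>
  pancakes with \<open>k\<close> joins of the first kind thus takes about \<open>3n/2 - k/4\<close> flips, and \<open>k\<close> must be \<open>n/3\<close>
  on average. To achieve this, the single pancakes are paired up beforehand: a pancake whose partner
  is still single is joined only to that partner, while a block on top prefers a single neighbour.
  A potential function that rewards adjacent intact pairs carries the induction.
\<close>

section \<open>Arrangements of oriented blocks\<close>

definition orient :: "bool \<times> 'a list \<Rightarrow> 'a list" where
  "orient = (\<lambda>(c, x). if c then x else rev x)"

definition layout :: "(bool \<times> 'a list) list \<Rightarrow> 'a list" where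
  "layout q = concat (map orient q)"

definition turn :: "(bool \<times> 'b) list \<Rightarrow> (bool \<times> 'b) list" where
  "turn q = map (\<lambda>(c, x). (\<not> c, x)) (rev q)"

text \<open>
  The orientation bit is kept for one-pancake blocks as well, on which it has no effect; this makes
  the uniform distribution independent of the block lengths.
\<close>

definition arrangements :: "'b set \<Rightarrow> (bool \<times> 'b) list set" where
  "arrangements I = {q. distinct (map snd q) \<and> snd ` set q = I}"

definition splits :: "'b set \<Rightarrow> ((bool \<times> 'b) list \<times> (bool \<times> 'b) list) set" where
  "splits J = {(A, C). A @ C \<in> arrangements J}"

lemma layout_simps [simp]:
  "layout [] = []" "layout (p # q) = orient p @ layout q" "layout (q @ r) = layout q @ layout r"
  by (simp_all add: layout_def)

lemma layout_turn [simp]: "layout (turn q) = rev (layout q)"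
proof (induction q)
  case (Cons p q)
  then show ?case by (cases p) (auto simp: turn_def layout_def orient_def)
qed (simp add: turn_def)

lemma turn_turn [simp]: "turn (turn q) = q"
  by (simp add: turn_def rev_map comp_def case_prod_beta)

lemma map_snd_turn [simp]: "map snd (turn q) = rev (map snd q)"
  by (simp add: turn_def rev_map comp_def case_prod_beta)

lemma snd_set_turn [simp]: "snd ` set (turn q) = snd ` set q"
  by (metis map_snd_turn set_map set_rev)

lemma finite_arrangements [simp]:
  assumes "finite I" shows "finite (arrangements I)"
proof (rule finite_subset)
  show "arrangements I \<subseteq> {q. set q \<subseteq> UNIV \<times> I \<and> length q \<le> card I}"
  proof safe
    fix q assume "q \<in> arrangements I"
    then have q: "distinct (map snd q)" "snd ` set q = I" by (auto simp: arrangements_def)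
    show "length q \<le> card I" using q distinct_card[of "map snd q"] by simp
  qed (auto simp: arrangements_def intro!: image_eqI)
  show "finite {q :: (bool \<times> 'a) list. set q \<subseteq> UNIV \<times> I \<and> length q \<le> card I}"
    using assms by (intro finite_lists_length_le) auto
qed

lemma finite_splits [simp]:
  assumes "finite I" shows "finite (splits I)"
proof (rule finite_subset)
  show "splits I \<subseteq> (\<Union>q\<in>arrangements I. (\<lambda>k. (take k q, drop k q)) ` {..length q})"
  proof safe
    fix A C assume "(A, C) \<in> splits I"
    then have "A @ C \<in> arrangements I" "(A, C) = (\<lambda>k. (take k (A @ C), drop k (A @ C))) (length A)"
      by (auto simp: splits_def)
    then show "(A, C) \<in> (\<Union>q\<in>arrangements I. (\<lambda>k. (take k q, drop k q)) ` {..length q})"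
      by (intro UN_I[of "A @ C"] image_eqI[of _ _ "length A"]) auto
  qed
qed (use assms in auto)

section \<open>Sums over arrangements, by a distinguished block, its orientation, or the top
  block\<close>

text \<open>As \<open>y\<close> occurs only once, an arrangement containing \<open>(c, y)\<close> is
  cut there in exactly one way.\<close>

lemma sum_arrangements_member:
  assumes "y \<notin> J" "finite J"
  shows "(\<Sum>q\<in>{q \<in> arrangements (insert y J). (c, y) \<in> set q \<and> Q q}. f q) =
         (\<Sum>(A, C)\<in>{(A, C) \<in> splits J. Q (A @ (c, y) # C)}. f (A @ (c, y) # C))"
proof -
  have "bij_betw (\<lambda>(A, C). A @ (c, y) # C) {(A, C) \<in> splits J. Q (A @ (c, y) # C)}
     {q \<in> arrangements (insert y J). (c, y) \<in> set q \<and> Q q}" (is "bij_betw ?h ?S ?T")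
  proof (rule bij_betw_imageI)
    have y: "y \<notin> snd ` set A" "y \<notin> snd ` set C" if "(A, C) \<in> splits J" for A C
      using that assms(1) unfolding splits_def arrangements_def by (simp_all add: image_Un) blast+
    show "inj_on ?h ?S"
    proof (rule inj_onI, clarify)
      fix A C A' C' assume *: "(A, C) \<in> splits J" "(A', C') \<in> splits J"
        "A @ (c, y) # C = A' @ (c, y) # C'"
      have "(c, y) \<notin> set A" "(c, y) \<notin> set C"
        using y[OF *(1)] by (metis image_eqI snd_conv)+
      then show "A = A' \<and> C = C'" using append_Cons_eq_iff[of "(c, y)" A C A' C'] *(3) by blast
    qed
    have mem: "A @ (c, y) # C \<in> arrangements (insert y J) \<longleftrightarrow> (A, C) \<in> splits J" for A C
    proof -
      have "y \<notin> snd ` set A \<Longrightarrow> y \<notin> snd ` set C \<Longrightarrow>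
        insert y (snd ` set A \<union> snd ` set C) = insert y J \<longleftrightarrow> snd ` set A \<union> snd ` set C = J"
        using assms(1) by (metis Un_iff insert_ident)
      then show ?thesis using y[of A C]
        unfolding splits_def arrangements_def by (auto simp del: image_eqI simp: image_Un)
    qed
    show "?h ` ?S = ?T"
    proof (intro equalityI subsetI)
      fix q assume "q \<in> ?h ` ?S"
      then obtain A C where "(A, C) \<in> splits J" "Q (A @ (c, y) # C)" "q = A @ (c, y) # C"
        by auto
      then show "q \<in> ?T" using mem[of A C] by simp
    next
      fix q assume q: "q \<in> ?T"
      then obtain A C where AC: "q = A @ (c, y) # C" by (auto dest: split_list)
      with q have "(A, C) \<in> ?S" using mem[of A C] by simp
      with AC show "q \<in> ?h ` ?S" by (intro image_eqI[of _ _ "(A, C)"]) simp_all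
    qed
  qed
  from sum.reindex_bij_betw[OF this, of f] show ?thesis unfolding case_prod_beta by (rule sym)
qed

lemma arrangements_member_xor:
  assumes "q \<in> arrangements I" "y \<in> I"
  shows "(True, y) \<in> set q \<longleftrightarrow> (False, y) \<notin> set q"
proof -
  have inj: "inj_on snd (set q)" and "y \<in> snd ` set q"
    using assms by (auto simp: arrangements_def distinct_map)
  then obtain c where "(c, y) \<in> set q" by auto
  then have "(True, y) \<in> set q \<or> (False, y) \<in> set q" by (cases c) auto
  moreover have "\<not> ((True, y) \<in> set q \<and> (False, y) \<in> set q)"
    using inj_onD[OF inj, of "(True, y)" "(False, y)"] by auto
  ultimately show ?thesis by blast
qed

lemma sum_bool_split:
  fixes f :: "(bool \<times> 'a) list \<Rightarrow> 'b::comm_monoid_add"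
  assumes "finite J" "y \<in> J"
  shows "(\<Sum>q\<in>{q \<in> arrangements J. Q q}. f q) =
         (\<Sum>q\<in>{q \<in> arrangements J. (True, y) \<in> set q \<and> Q q}. f q) +
         (\<Sum>q\<in>{q \<in> arrangements J. (False, y) \<in> set q \<and> Q q}. f q)"
proof -
  have "{q \<in> arrangements J. Q q} = {q \<in> arrangements J. (True, y) \<in> set q \<and> Q q} \<union>
      {q \<in> arrangements J. (False, y) \<in> set q \<and> Q q}"
    and "{q \<in> arrangements J. (True, y) \<in> set q \<and> Q q} \<inter>
      {q \<in> arrangements J. (False, y) \<in> set q \<and> Q q} = {}"
    using arrangements_member_xor[OF _ assms(2)] by blast+
  then show ?thesis using assms by (simp add: sum.union_disjoint)
qed

lemma sum_arrangements_insert: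
  assumes "y \<notin> J" "finite J"
  shows "(\<Sum>q\<in>arrangements (insert y J). f q) =
         (\<Sum>(A, C)\<in>splits J. f (A @ (True, y) # C)) + (\<Sum>(A, C)\<in>splits J. f (A @ (False, y) # C))"
  using sum_bool_split[of "insert y J" y f "\<lambda>_. True"] assms
    sum_arrangements_member[OF assms, of f True "\<lambda>_. True"]
    sum_arrangements_member[OF assms, of f False "\<lambda>_. True"]
  by simp

lemma sum_arrangements_top:
  assumes "finite I" "I \<noteq> {}"
  shows "(\<Sum>q\<in>arrangements I. f q) =
         (\<Sum>x\<in>I. \<Sum>q\<in>arrangements (I - {x}). f ((True, x) # q) + f ((False, x) # q))"
proof -
  have "(\<Sum>q\<in>arrangements I. f q) = 
      (\<Sum>p\<in>Sigma I (\<lambda>x. UNIV \<times> arrangements (I - {x})). f ((fst (snd p), fst p) # snd (snd p)))"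
  proof (rule sum.reindex_bij_witness[where i = "\<lambda>p. (fst (snd p), fst p) # snd (snd p)" and 
        j = "\<lambda>q. (snd (hd q), fst (hd q), tl q)"])
    fix q assume q: "q \<in> arrangements I"
    with assms(2) obtain c x r where r: "q = (c, x) # r" 
      by (cases q) (auto simp: arrangements_def)
    with q show "(snd (hd q), fst (hd q), tl q) \<in> Sigma I (\<lambda>x. UNIV \<times> arrangements (I - {x}))"
      by (auto simp: arrangements_def)
    let ?p = "(snd (hd q), fst (hd q), tl q)"
    show "(fst (snd ?p), fst ?p) # snd (snd ?p) = q"
      and "f ((fst (snd ?p), fst ?p) # snd (snd ?p)) = f q"
      using r by simp_all
  next
    fix p :: "'a \<times> bool \<times> (bool \<times> 'a) list" assume "p \<in> Sigma I (\<lambda>x. UNIV \<times> arrangements (I - {x}))"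
    then obtain x c r where "p = (x, c, r)" "x \<in> I" "distinct (map snd r)" "snd ` set r = I - {x}"
      by (auto simp: arrangements_def)
    then show "(fst (snd p), fst p) # snd (snd p) \<in> arrangements I"
      by (simp add: arrangements_def insert_absorb)
  qed auto
  also have "\<dots> = (\<Sum>x\<in>I. \<Sum>q\<in>UNIV \<times> arrangements (I - {x}). f ((fst q, x) # snd q))"
    using assms by (subst sum.Sigma) (auto simp: case_prod_beta)
  also have "\<dots> = (\<Sum>x\<in>I. \<Sum>q\<in>arrangements (I - {x}). f ((True, x) # q) + f ((False, x) # q))"
    by (simp add: sum.cartesian_product[symmetric, of "\<lambda>c q. f ((c, _) # q)", unfolded case_prod_beta]
        UNIV_bool sum.distrib add.commute)
  finally show ?thesis .
qed

text \<open>This is why a flip that reverses the blocks it passes over keeps the distribution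
  uniform.\<close>

lemma bij_betw_turn_splits:
  "bij_betw (\<lambda>(A, C). (turn A, C)) (splits J) (splits J)"
proof (rule bij_betw_byWitness[where f' = "\<lambda>(A, C). (turn A, C)"])
  have "(turn A, C) \<in> splits J" if "(A, C) \<in> splits J" for A C
    using that by (simp add: splits_def arrangements_def image_Un)
  then show "(\<lambda>(A, C). (turn A, C)) ` splits J \<subseteq> splits J" 
    and "(\<lambda>(A, C). (turn A, C)) ` splits J \<subseteq> splits J" by auto
qed auto

lemma sum_splits_turn: "(\<Sum>(A, C)\<in>splits J. f (turn A) C) = (\<Sum>(A, C)\<in>splits J. f A C)"
  using sum.reindex_bij_betw[OF bij_betw_turn_splits, of "\<lambda>(A, C). f A C"] by (simp add: case_prod_beta)

lemma card_arrangements: "finite I \<Longrightarrow> card (arrangements I) = 2 ^ card I * fact (card I)"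
proof (induction "card I" arbitrary: I)
  case 0
  then have "arrangements I = {[]}" by (auto simp: arrangements_def)
  with 0 show ?case by simp
next
  case (Suc m)
  then have "I \<noteq> {}" by auto
  have "card (arrangements I) = (\<Sum>x\<in>I. \<Sum>q\<in>arrangements (I - {x}). 1 + 1)"
    using sum_arrangements_top[of I "\<lambda>_. 1 :: nat"] Suc \<open>I \<noteq> {}\<close> by simp
  also have "\<dots> = (\<Sum>x\<in>I. 2 * (2 ^ m * fact m :: nat))"
  proof (rule sum.cong[OF refl])
    fix x assume "x \<in> I"
    then have "card (arrangements (I - {x})) = 2 ^ m * fact m"
      using Suc(1)[of "I - {x}"] Suc(2,3) by (metis \<open>x \<in> I\<close> card_Diff_singleton diff_Suc_1 finite_Diff)
    then show "(\<Sum>q\<in>arrangements (I - {x}). 1 + 1) = (2 * (2 ^ m * fact m) :: nat)" by simp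
  qed
  finally show ?case by (simp add: algebra_simps flip: Suc(2))
qed

lemma card_arrangements_insert:
  assumes "y \<notin> J" "finite J"
  shows "card (arrangements (insert y J)) = 2 * card (splits J)"
  using sum_arrangements_insert[OF assms, of "\<lambda>_. 1 :: nat"] by simp

text \<open>Toggling one bit cannot change the count, since deleting that block leaves the same
  splits; so the four classes of bits are equally large.\<close>

lemma card_bits:
  assumes "y \<noteq> e" "y \<notin> J" "e \<notin> J" "finite J"
  shows "4 * card {q \<in> arrangements (insert y (insert e J)). (c, y) \<in> set q \<and> (b, e) \<in> set q} =
    card (arrangements (insert y (insert e J)))"
proof -
  let ?K = "insert y (insert e J)"
  let ?n = "\<lambda>c b. card {q \<in> arrangements ?K. (c, y) \<in> set q \<and> (b, e) \<in> set q}"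
  have 1: "?n c b = card {(A, C) \<in> splits (insert e J). (b, e) \<in> set (A @ C)}" for c b
    using sum_arrangements_member[of y "insert e J" "\<lambda>_. 1 :: nat" c "\<lambda>q. (b, e) \<in> set q"] assms by simp
  have 2: "?n c b = card {(A, C) \<in> splits (insert y J). (c, y) \<in> set (A @ C)}" for c b
    using sum_arrangements_member[of e "insert y J" "\<lambda>_. 1 :: nat" b "\<lambda>q. (c, y) \<in> set q"] assms
    unfolding insert_commute[of e y] by (simp add: conj_commute)
  have bit_e: "card {q \<in> arrangements ?K. (c, y) \<in> set q} = ?n c True + ?n c False" for c
    using sum_bool_split[of ?K e "\<lambda>_. 1 :: nat" "\<lambda>q. (c, y) \<in> set q"] assms(4) by (simp add: conj_commute)
  have "card (arrangements ?K) = ?n True True + ?n True False + (?n False True + ?n False False)"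
    using sum_bool_split[of ?K y "\<lambda>_. 1 :: nat" "\<lambda>_. True"] assms(4)
    by (simp add: bit_e)
  moreover have eq: "?n c b = ?n True True" for c b
    using 1[of c b] 1[of True b] 2[of True b] 2[of True True] by argo
  ultimately show ?thesis
    by (simp add: eq[of c b] eq[of True False] eq[of False True] eq[of False False])
qed

section \<open>Joining the top block\<close>

text \<open>\<open>d\<close> abstracts the flip distance to the one inequality that the joins rely
  on.\<close>

locale flip_cost =
  fixes d :: "'a list \<Rightarrow> real"
  assumes flip: "d (A @ B) \<le> 1 + d (rev A @ B)"
begin

lemma join_right: "d (X @ A @ Y @ C) \<le> 1 + d (rev A @ rev X @ Y @ C)"
  using flip[of "X @ A" "Y @ C"] by simp

text \<open>The first flip reverses \<open>X @ A @ Y\<close>, the second restores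
  \<open>A @ Y\<close> and leaves \<open>X\<close> turned below it.\<close>

lemma join_left: "d (X @ A @ Y @ C) \<le> 2 + d (A @ Y @ rev X @ C)"
  using flip[of "X @ A @ Y" C] flip[of "rev Y @ rev A" "rev X @ C"] by simp

text \<open>A preliminary flip of \<open>X\<close> alone makes it arrive below \<open>Y\<close>
  unturned.\<close>

lemma join_turned_left: "d (X @ A @ Y @ C) \<le> 3 + d (A @ Y @ X @ C)"
  using flip[of X "A @ Y @ C"] join_left[of "rev X" A Y C] by simp

definition total :: "'a list set \<Rightarrow> real" where
  "total I = (\<Sum>q\<in>arrangements I. d (layout q))"

text \<open>Both orientations of the top block are summed, so one flip throughout contributes
  \<open>2 * card (arrangements J)\<close>.\<close>

definition total_top :: "'a list \<Rightarrow> 'a list set \<Rightarrow> real" where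
  "total_top x J = (\<Sum>q\<in>arrangements J. d (x @ layout q) + d (rev x @ layout q))"

definition total_with :: "'a list set \<Rightarrow> 'a list \<Rightarrow> real" where
  "total_with J M = (\<Sum>(A, C)\<in>splits J. d (layout A @ M @ layout C))"

lemma total_insert:
  assumes "z \<notin> J" "finite J"
  shows "total (insert z J) = total_with J z + total_with J (rev z)"
  using sum_arrangements_insert[OF assms, of "\<lambda>q. d (layout q)"]
  by (simp add: total_def total_with_def orient_def)

lemma total_by_top:
  assumes "finite I" "I \<noteq> {}"
  shows "total I = (\<Sum>x\<in>I. total_top x (I - {x}))"
  using sum_arrangements_top[OF assms, of "\<lambda>q. d (layout q)"]
  by (simp add: total_def total_top_def orient_def)

lemma sum_splits_le:
  assumes "\<And>A C. (A, C) \<in> splits J \<Longrightarrow> f A C \<le> k + g A C"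
  shows "(\<Sum>(A, C)\<in>splits J. f A C) \<le> k * real (card (splits J)) + (\<Sum>(A, C)\<in>splits J. g A C)"
proof -
  have "(\<Sum>(A, C)\<in>splits J. f A C) \<le> (\<Sum>(A, C)\<in>splits J. k + g A C)"
    using assms by (intro sum_mono) auto
  then show ?thesis by (simp add: case_prod_beta sum.distrib mult.commute)
qed

definition gap_top :: "'a list \<Rightarrow> 'a list \<Rightarrow> 'a list set \<Rightarrow> real" where
  "gap_top X Y J = (\<Sum>(A, C)\<in>splits J. d (X @ layout A @ Y @ layout C))"

lemma gap_join_right: "gap_top X Y J \<le> real (card (splits J)) + total_with J (rev X @ Y)"
proof -
  have "gap_top X Y J \<le> 1 * real (card (splits J)) + 
      (\<Sum>(A, C)\<in>splits J. d (layout (turn A) @ (rev X @ Y) @ layout C))"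
    unfolding gap_top_def
    by (rule sum_splits_le) (use join_right in simp)
  also have "(\<Sum>(A, C)\<in>splits J. d (layout (turn A) @ (rev X @ Y) @ layout C)) = 
      total_with J (rev X @ Y)"
    unfolding total_with_def by (rule sum_splits_turn)
  finally show ?thesis by simp
qed

lemma gap_join_left: "gap_top X Y J \<le> 2 * real (card (splits J)) + total_with J (Y @ rev X)"
  unfolding gap_top_def total_with_def
  by (rule sum_splits_le) (use join_left in simp)

lemma total_top_insert:
  assumes "y \<notin> J" "finite J"
  shows "total_top x (insert y J) =
    gap_top x y J + gap_top x (rev y) J + gap_top (rev x) y J + gap_top (rev x) (rev y) J"
  using sum_arrangements_insert[OF assms, of "\<lambda>q. d (x @ layout q)"]
    sum_arrangements_insert[OF assms, of "\<lambda>q. d (rev x @ layout q)"]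
  by (simp add: total_top_def gap_top_def orient_def sum.distrib)

text \<open>
  The left-hand sides add up two top orientations, hence the average of \<open>3/2\<close> flips. Both
  orientations of the joined block arise equally often, so that uniformity is preserved.
\<close>

lemma join_block_single:
  assumes "rev s = s" "z = s @ b \<or> z = b @ s"
    and "b \<notin> J" "s \<notin> J" "z \<notin> J" "finite J"
  shows "total_top b (insert s J) \<le> 3 * card (arrangements (insert z J)) + 2 * total (insert z J)"
    and "total_top s (insert b J) \<le> 3 * card (arrangements (insert z J)) + 2 * total (insert z J)"
proof -
  \<comment> \<open>As \<open>s\<close> is a palindrome, \<open>rev z\<close> has
    \<open>rev b\<close> on the other side of \<open>s\<close>. A right join for one orientation of
    \<open>b\<close> and a left join for the other produce \<open>z\<close> and
    \<open>rev z\<close>, once each.\<close>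
  have rz: "total_with J (rev z) = total_with J (rev b @ s) \<and> total_with J z = total_with J (s @ b) \<or>
    total_with J (rev z) = total_with J (s @ rev b) \<and> total_with J z = total_with J (b @ s)"
    using assms(1,2) by auto
  show "total_top b (insert s J) \<le> 3 * card (arrangements (insert z J)) + 2 * total (insert z J)"
    using rz gap_join_right[of b s J] gap_join_left[of "rev b" s J] 
      gap_join_right[of "rev b" s J] gap_join_left[of "b" s J] assms
    by (auto simp: total_top_insert total_insert card_arrangements_insert)
  show "total_top s (insert b J) \<le> 3 * card (arrangements (insert z J)) + 2 * total (insert z J)"
    using rz gap_join_right[of s b J] gap_join_left[of s b J] 
      gap_join_right[of s "rev b" J] gap_join_left[of s "rev b" J] assms
    by (auto simp: total_top_insert total_insert card_arrangements_insert)
qed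

text \<open>One flip yields \<open>x @ y\<close> when \<open>x\<close> is on top and its reverse
  \<open>y @ x\<close> when \<open>y\<close> is; only the two together cover both orientations of
  the new block evenly.\<close>

lemma join_singles:
  assumes "rev x = x" "rev y = y" "x \<notin> J" "y \<notin> J" "x @ y \<notin> J" "finite J"
  shows "total_top x (insert y J) + total_top y (insert x J) \<le>
    4 * card (arrangements (insert (x @ y) J)) + 4 * total (insert (x @ y) J)"
  using gap_join_right[of x y J] gap_join_right[of y x J] assms
  by (auto simp: total_top_insert total_insert card_arrangements_insert)

text \<open>A join carried out only in one class of orientations of \<open>y\<close> and
  \<open>e\<close>; the resulting stacks still remember the bit of \<open>e\<close>.\<close>

lemma sum_member_join:
  assumes y: "y \<notin> J" "finite J" and e: "e \<in> J"
    and le: "\<And>A C. f (A @ (c, y) # C) \<le> k + d (layout A @ M @ layout C)"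
  shows "(\<Sum>q\<in>{q \<in> arrangements (insert y J). (c, y) \<in> set q \<and> (b, e) \<in> set q}. f q) \<le>
    k * card {q \<in> arrangements (insert y J). (c, y) \<in> set q \<and> (b, e) \<in> set q} +
    (\<Sum>(A, C)\<in>{(A, C) \<in> splits J. (b, e) \<in> set (A @ C)}. d (layout A @ M @ layout C))"
proof -
  let ?S = "{(A, C) \<in> splits J. (b, e) \<in> set (A @ C)}"
  have *: "(\<Sum>q\<in>{q \<in> arrangements (insert y J). (c, y) \<in> set q \<and> (b, e) \<in> set q}. g q) =
      (\<Sum>(A, C)\<in>?S. g (A @ (c, y) # C))" for g :: "_ \<Rightarrow> real"
  proof -
    have "e \<noteq> y" using y(1) e by auto
    then show ?thesis using sum_arrangements_member[OF y, of g c "\<lambda>q. (b, e) \<in> set q"] by simp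
  qed
  have "(\<Sum>(A, C)\<in>?S. f (A @ (c, y) # C)) \<le> (\<Sum>(A, C)\<in>?S. k + d (layout A @ M @ layout C))"
    using le by (intro sum_mono) auto
  also have "\<dots> = (\<Sum>(A, C)\<in>?S. k) + (\<Sum>(A, C)\<in>?S. d (layout A @ M @ layout C))"
    by (simp add: case_prod_beta sum.distrib)
  also have "(\<Sum>(A, C)\<in>?S. k) = k * card {q \<in> arrangements (insert y J). (c, y) \<in> set q \<and> (b, e) \<in> set q}"
    using *[of "\<lambda>_. k"] by (auto simp: mult.commute)
  finally show ?thesis using *[of f] by simp
qed

lemma total_with_split_bit:
  assumes "finite J" "e \<in> J"
  shows "total_with J M = 
    (\<Sum>(A, C)\<in>{(A, C) \<in> splits J. (True, e) \<in> set (A @ C)}. d (layout A @ M @ layout C)) +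
    (\<Sum>(A, C)\<in>{(A, C) \<in> splits J. (False, e) \<in> set (A @ C)}. d (layout A @ M @ layout C))"
proof -
  let ?S = "\<lambda>b. {(A, C) \<in> splits J. (b, e) \<in> set (A @ C)}"
  have "(True, e) \<in> set (A @ C) \<longleftrightarrow> (False, e) \<notin> set (A @ C)" if "(A, C) \<in> splits J" for A C
    using arrangements_member_xor[OF _ assms(2), of "A @ C"] that by (simp only: splits_def mem_Collect_eq case_prod_conv)
  then have union: "splits J = ?S True \<union> ?S False" and disj: "?S True \<inter> ?S False = {}"
    by (auto simp del: set_append)
  have fin: "finite (?S b)" for b
    by (rule finite_subset[of _ "splits J"]) (use assms in auto)
  have "total_with J M = (\<Sum>(A, C)\<in>?S True \<union> ?S False. d (layout A @ M @ layout C))"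
    unfolding total_with_def using union by (rule sum.cong) simp
  then show ?thesis using sum.union_disjoint[OF fin fin disj] by (rule trans)
qed

text \<open>
  Here \<open>y\<close>, \<open>x\<close>, \<open>e\<close> are consecutive and \<open>x\<close> is on top. If \<open>x\<close> shows the end adjacent to \<open>y\<close>, then one flip
  joins \<open>y\<close> when \<open>y\<close> is turned. Otherwise the orientation of \<open>e\<close> decides: three flips join \<open>y\<close> if \<open>e\<close> is
  not turned, and two flips join \<open>e\<close> if it is. This reveals the orientation of the block left over,
  but the mirrored rule for \<open>rev x\<close> produces exactly the complementary cases.
\<close>

lemma join_blocks:
  assumes "y \<noteq> e" "y \<notin> J" "e \<notin> J" "y @ x \<notin> insert e J" "x @ e \<notin> insert y J" "finite J"
  shows "total_top x (insert y (insert e J)) \<le> 7 / 2 * card (arrangements (insert y (insert e J))) +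
    total (insert (y @ x) (insert e J)) + total (insert (x @ e) (insert y J))"
proof -
  let ?K = "insert y (insert e J)"
  \<comment> \<open>\<open>cl c b\<close> fixes the orientations of \<open>y\<close> and
    \<open>e\<close>, a quarter of all arrangements; \<open>R\<close> is the part of
    \<open>total_with\<close> in which the block left over has a known orientation.\<close>
  define cl where "cl = (\<lambda>c b. {q \<in> arrangements ?K. (c, y) \<in> set q \<and> (b, e) \<in> set q})"
  define R where "R = (\<lambda>J e b M. \<Sum>(A, C)\<in>{(A, C) \<in> splits J. (b, e) \<in> set (A @ C)}. d (layout A @ M @ layout C))"
  define a where "a = real (card (arrangements ?K))"
  have card: "real (card (cl c b)) = a / 4" for c b
    using card_bits[OF assms(1-3,6), of c b] unfolding cl_def a_def by linarith
  have swap: "insert e (insert y J) = ?K" by (rule insert_commute)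
  have cl_swap: "cl c b = {q \<in> arrangements (insert e (insert y J)). (b, e) \<in> set q \<and> (c, y) \<in> set q}" for c b
    unfolding cl_def swap by blast
  have splits_y: "2 * real (card (splits (insert e J))) = a"
    using card_arrangements_insert[of y "insert e J"] assms by (simp add: a_def)
  have splits_e: "2 * real (card (splits (insert y J))) = a"
    using card_arrangements_insert[of e "insert y J"] assms by (simp add: a_def swap)
  have at_y: "(\<Sum>q\<in>cl c b. f q) \<le> k * (a / 4) + R (insert e J) e b M"
    if "\<And>A C. f (A @ (c, y) # C) \<le> k + d (layout A @ M @ layout C)" for f c b k M
    using sum_member_join[of y "insert e J" e f c k M b] that assms card unfolding cl_def R_def by simp
  have at_e: "(\<Sum>q\<in>cl c b. f q) \<le> k * (a / 4) + R (insert y J) y c M"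
    if "\<And>A C. f (A @ (b, e) # C) \<le> k + d (layout A @ M @ layout C)" for f c b k M
    using sum_member_join[of e "insert y J" y f b k M c] that assms card[of c b] unfolding cl_swap R_def by simp
  have x1: "(\<Sum>q\<in>arrangements ?K. d (x @ layout q)) = 
      (\<Sum>q\<in>cl True True. d (x @ layout q)) + (\<Sum>q\<in>cl True False. d (x @ layout q)) + gap_top x (rev y) (insert e J)"
    using sum_bool_split[of ?K y "\<lambda>q. d (x @ layout q)" "\<lambda>_. True"] 
      sum_bool_split[of ?K e "\<lambda>q. d (x @ layout q)" "\<lambda>q. (True, y) \<in> set q"]
      sum_arrangements_member[of y "insert e J" "\<lambda>q. d (x @ layout q)" False "\<lambda>_. True"] assms
    by (simp add: conj_commute cl_def gap_top_def orient_def)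
  have x2: "(\<Sum>q\<in>arrangements ?K. d (rev x @ layout q)) = 
      (\<Sum>q\<in>cl True False. d (rev x @ layout q)) + (\<Sum>q\<in>cl False False. d (rev x @ layout q)) + gap_top (rev x) e (insert y J)"
    using sum_bool_split[of ?K e "\<lambda>q. d (rev x @ layout q)" "\<lambda>_. True"] 
      sum_bool_split[of ?K y "\<lambda>q. d (rev x @ layout q)" "\<lambda>q. (False, e) \<in> set q"]
      sum_arrangements_member[of e "insert y J" "\<lambda>q. d (rev x @ layout q)" True "\<lambda>_. True"] assms
    by (simp add: conj_commute cl_def gap_top_def orient_def swap)
  \<comment> \<open>For each orientation of \<open>x\<close>, the flips number 3 on a quarter, 2 on
    a quarter and 1 on a half, or 7/4 on average; the two orientations add up to 7/2.\<close>
  have "(\<Sum>q\<in>cl True True. d (x @ layout q)) \<le> 3 * (a / 4) + R (insert e J) e True (y @ x)"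
    by (rule at_y) (use join_turned_left in \<open>simp add: orient_def\<close>)
  moreover have "(\<Sum>q\<in>cl True False. d (x @ layout q)) \<le> 2 * (a / 4) + R (insert y J) y True (rev e @ rev x)"
    by (rule at_e) (use join_left in \<open>simp add: orient_def\<close>)
  moreover have "(\<Sum>q\<in>cl False False. d (rev x @ layout q)) \<le> 3 * (a / 4) + R (insert y J) y False (rev e @ rev x)"
    by (rule at_e) (use join_turned_left in \<open>simp add: orient_def\<close>)
  moreover have "(\<Sum>q\<in>cl True False. d (rev x @ layout q)) \<le> 2 * (a / 4) + R (insert e J) e False (y @ x)"
    by (rule at_y) (use join_left[of "rev x"] in \<open>simp add: orient_def\<close>)
  moreover have "gap_top x (rev y) (insert e J) \<le> a / 2 + total_with (insert e J) (rev x @ rev y)"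
    using gap_join_right[of x "rev y" "insert e J"] splits_y by simp
  moreover have "gap_top (rev x) e (insert y J) \<le> a / 2 + total_with (insert y J) (x @ e)"
    using gap_join_right[of "rev x" e "insert y J"] splits_e by simp
  moreover have "R (insert e J) e True (y @ x) + R (insert e J) e False (y @ x) = total_with (insert e J) (y @ x)"
    using total_with_split_bit[of "insert e J" e "y @ x"] assms unfolding R_def by simp
  moreover have "R (insert y J) y True (rev e @ rev x) + R (insert y J) y False (rev e @ rev x) = 
      total_with (insert y J) (rev e @ rev x)"
    using total_with_split_bit[of "insert y J" y "rev e @ rev x"] assms unfolding R_def by simp
  moreover have "total (insert (y @ x) (insert e J)) = total_with (insert e J) (y @ x) + total_with (insert e J) (rev x @ rev y)"
    using assms by (simp add: total_insert)
  moreover have "total (insert (x @ e) (insert y J)) = total_with (insert y J) (x @ e) + total_with (insert y J) (rev e @ rev x)"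
    using assms by (simp add: total_insert)
  moreover have "total_top x ?K = (\<Sum>q\<in>arrangements ?K. d (x @ layout q)) + (\<Sum>q\<in>arrangements ?K. d (rev x @ layout q))"
    by (simp add: total_top_def sum.distrib)
  ultimately show ?thesis using x1 x2 unfolding a_def[symmetric] by linarith
qed

end

section \<open>Cyclic sequences of segments\<close>

text \<open>
  \<open>Couple x y\<close> is a pair of partners that are both still single. \<open>Block l b r\<close> is a block \<open>b\<close> with the
  optional single pancakes \<open>l\<close> and \<open>r\<close> next to it whose partners have been absorbed into \<open>b\<close>.
\<close>

datatype 'a segment = Couple 'a 'a | Block "'a option" "'a list" "'a option"

fun is_couple :: "'a segment \<Rightarrow> bool" where
  "is_couple (Couple x y) = True"
| "is_couple (Block l b r) = False"

definition widow :: "'a option \<Rightarrow> 'a list list" where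
  "widow w = (case w of None \<Rightarrow> [] | Some x \<Rightarrow> [[x]])"

lemma widow_simps [simp]: "widow None = []" "widow (Some x) = [[x]]"
  by (simp_all add: widow_def)

fun segment_items :: "'a segment \<Rightarrow> 'a list list" where
  "segment_items (Couple x y) = [[x], [y]]"
| "segment_items (Block l b r) = widow l @ b # widow r"

definition items :: "'a segment list \<Rightarrow> 'a list list" where
  "items us = concat (map segment_items us)"

lemma items_simps [simp]:
  "items [] = []" "items (u # us) = segment_items u @ items us" "items (us @ vs) = items us @ items vs"
  by (simp_all add: items_def)

fun weight :: "'a segment \<Rightarrow> real" where
  "weight (Couple x y) = 69"
| "weight (Block l b r) = 42 + 36 * (length (widow l) + length (widow r))"

fun adjacent_couples :: "'a segment list \<Rightarrow> real" where
  "adjacent_couples (u # v # us) = of_bool (is_couple u \<and> is_couple v) + adjacent_couples (v # us)"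
| "adjacent_couples us = 0"

text \<open>
  Apart from the unit \<open>1/24\<close>, a single pancake costs \<open>36\<close> and a block \<open>42\<close>; an intact couple is worth
  a discount of \<open>3\<close> and two adjacent ones a further discount of \<open>1\<close>. Appending the head closes the
  cycle.
\<close>

definition potential :: "'a segment list \<Rightarrow> real" where
  "potential us = (sum_list (map weight us) - adjacent_couples (us @ [hd us])) / 24"

definition first_couple :: "'a segment list \<Rightarrow> real" where
  "first_couple us = of_bool (us \<noteq> [] \<and> is_couple (hd us))"

definition last_couple :: "'a segment list \<Rightarrow> real" where
  "last_couple us = of_bool (us \<noteq> [] \<and> is_couple (last us))"

lemma first_couple_simps [simp]:
  "first_couple [] = 0" "first_couple (u # us) = of_bool (is_couple u)" 
  "first_couple (us @ [v]) = (if us = [] then of_bool (is_couple v) else first_couple us)"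
  by (simp_all add: first_couple_def)

lemma last_couple_simps [simp]:
  "last_couple [] = 0" "last_couple (us @ [u]) = of_bool (is_couple u)"
  "last_couple (v # us) = (if us = [] then of_bool (is_couple v) else last_couple us)"
  by (simp_all add: last_couple_def)

lemma adjacent_couples_Cons: "adjacent_couples (u # us) = of_bool (is_couple u) * first_couple us + adjacent_couples us"
  by (cases us) auto

lemma adjacent_couples_snoc: "adjacent_couples (us @ [u]) = adjacent_couples us + last_couple us * of_bool (is_couple u)"
  by (induction us) (auto simp: adjacent_couples_Cons)

lemma potential_rotate1: "potential (us @ [u]) = potential (u # us)"
  by (cases us) (auto simp: potential_def adjacent_couples_Cons adjacent_couples_snoc 
      simp flip: append_Cons append_assoc)

lemma potential_rotate: "potential (rotate k us) = potential us"
proof (induction k)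
  case (Suc k)
  then show ?case by (cases "rotate k us") (auto simp: potential_rotate1)
qed simp

lemma potential_Block:
  "potential (Block l b r # us) = (42 + 36 * (length (widow l) + length (widow r)) + 
    sum_list (map weight us) - adjacent_couples us) / 24"
  by (simp add: potential_def adjacent_couples_Cons adjacent_couples_snoc)

text \<open>With \<open>us = []\<close> the couple would count as its own neighbour.\<close>

lemma potential_Couple:
  assumes "us \<noteq> []"
  shows "potential (Couple x y # us) = 
    (69 + sum_list (map weight us) - adjacent_couples us - first_couple us - last_couple us) / 24"
  using assms by (simp add: potential_def adjacent_couples_Cons adjacent_couples_snoc flip: append_Cons)

lemma distinct_concat_items:
  assumes "distinct (concat xs)" "[] \<notin> set xs"
  shows "distinct xs"
  using assms
proof (induction xs)
  case (Cons x xs)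
  then have "x \<notin> set xs" by (cases x) auto
  with Cons show ?case by simp
qed simp

section \<open>Merging items of a cyclic sequence\<close>

locale stack_sorting = flip_cost d for d :: "'a list \<Rightarrow> real" +
  fixes target :: "'a list"
  assumes distinct_target: "distinct target"
    and sorted: "d target = 0"
begin

text \<open>Any rotation of \<open>target\<close> is allowed because sizes are read cyclically.
  Without empty items, distinct pancakes force distinct items.\<close>

definition valid :: "'a segment list \<Rightarrow> bool" where
  "valid us \<longleftrightarrow> [] \<notin> set (items us) \<and> (\<exists>k. concat (items us) = rotate k target)"

lemma valid_append_commute: "valid (us @ vs) \<Longrightarrow> valid (vs @ us)"
  unfolding valid_def by (auto, metis rotate_append rotate_rotate)

lemma valid_rotate: "valid us \<Longrightarrow> valid (rotate k us)"
  by (metis append_take_drop_id rotate_drop_take valid_append_commute)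

lemma valid_merge:
  "\<lbrakk>valid us; concat (items vs) = concat (items us); [] \<notin> set (items vs)\<rbrakk> \<Longrightarrow> valid vs"
  by (auto simp: valid_def)

lemma distinct_items: "valid us \<Longrightarrow> distinct (items us)"
  unfolding valid_def by (metis distinct_concat_items distinct_rotate distinct_target)

abbreviation tot :: "'a segment list \<Rightarrow> real" where "tot us \<equiv> total (set (items us))"
abbreviation number :: "'a segment list \<Rightarrow> real" where "number us \<equiv> card (arrangements (set (items us)))"
abbreviation top_cost :: "'a segment list \<Rightarrow> 'a list \<Rightarrow> real" where
  "top_cost us x \<equiv> total_top x (set (items us) - {x})"

text \<open>The number of arrangements depends only on how many items there are, so all outcomes of
  a merge share the same normalization.\<close>

lemma number_eq: "valid us \<Longrightarrow> number us = 2 ^ length (items us) * fact (length (items us))"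
  by (simp add: card_arrangements distinct_card distinct_items)

lemma set_items_mset: "set (items us) = set_mset (mset (items us))"
  by simp

text \<open>Multisets describe the merge regardless of where it happens in the cycle; distinctness
  of the items supplies the freshness conditions of the join.\<close>

lemma merge_block_single:
  assumes "valid us" "valid vs" "rev s = s" "z = s @ b \<or> z = b @ s"
    and us: "mset (items us) = add_mset s (add_mset b M)" and vs: "mset (items vs) = add_mset z M"
  shows "top_cost us b \<le> 3 * number vs + 2 * tot vs" "top_cost us s \<le> 3 * number vs + 2 * tot vs"
proof -
  have set: "set (items us) = insert s (insert b (set_mset M))" "set (items vs) = insert z (set_mset M)"
    unfolding set_items_mset us vs by auto
  have "count (mset (items us)) x \<le> 1" "count (mset (items vs)) x \<le> 1" for x
    using distinct_items[OF assms(1)] distinct_items[OF assms(2)] by (simp_all add: distinct_count_atmost_1)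
  from this(1)[of s] this(1)[of b] this(2)[of z] have fresh: "s \<noteq> b" "s \<notin># M" "b \<notin># M" "z \<notin># M"
    unfolding us vs by (auto simp: count_eq_zero_iff split: if_splits)
  then have "set (items us) - {b} = insert s (set_mset M)" "set (items us) - {s} = insert b (set_mset M)"
    using set by auto
  then show "top_cost us b \<le> 3 * number vs + 2 * tot vs" "top_cost us s \<le> 3 * number vs + 2 * tot vs"
    using join_block_single[OF assms(3,4), of "set_mset M"] fresh set(2) by auto
qed

lemma merge_singles:
  assumes "valid us" "valid vs" 
    and us: "mset (items us) = add_mset [x] (add_mset [y] M)" and vs: "mset (items vs) = add_mset [x, y] M"
  shows "top_cost us [x] + top_cost us [y] \<le> 4 * number vs + 4 * tot vs"
proof -
  have set: "set (items us) = insert [x] (insert [y] (set_mset M))" "set (items vs) = insert [x, y] (set_mset M)"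
    unfolding set_items_mset us vs by auto
  have "count (mset (items us)) x \<le> 1" "count (mset (items vs)) x \<le> 1" for x
    using distinct_items[OF assms(1)] distinct_items[OF assms(2)] by (simp_all add: distinct_count_atmost_1)
  from this(1)[of "[x]"] this(1)[of "[y]"] this(2)[of "[x, y]"] 
  have fresh: "x \<noteq> y" "[x] \<notin># M" "[y] \<notin># M" "[x, y] \<notin># M"
    unfolding us vs by (auto simp: count_eq_zero_iff split: if_splits)
  then have "set (items us) - {[x]} = insert [y] (set_mset M)" "set (items us) - {[y]} = insert [x] (set_mset M)"
    using set by auto
  then show ?thesis
    using join_singles[of "[x]" "[y]" "set_mset M"] fresh set(2) by auto
qed

lemma merge_blocks:
  assumes "valid us" "valid vs" "valid ws"
    and us: "mset (items us) = add_mset y (add_mset x (add_mset e M))" 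
    and vs: "mset (items vs) = add_mset (y @ x) (add_mset e M)"
    and ws: "mset (items ws) = add_mset (x @ e) (add_mset y M)"
  shows "top_cost us x \<le> 7 / 2 * number vs + tot vs + tot ws"
proof -
  have set: "set (items us) = insert y (insert x (insert e (set_mset M)))" 
    "set (items vs) = insert (y @ x) (insert e (set_mset M))" "set (items ws) = insert (x @ e) (insert y (set_mset M))"
    unfolding set_items_mset us vs ws by auto
  have "count (mset (items us)) x \<le> 1" "count (mset (items vs)) x \<le> 1" "count (mset (items ws)) x \<le> 1" for x
    using distinct_items[OF assms(1)] distinct_items[OF assms(2)] distinct_items[OF assms(3)]
    by (simp_all add: distinct_count_atmost_1)
  from this(1)[of x] this(1)[of y] this(1)[of e] this(2)[of "y @ x"] this(3)[of "x @ e"]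
  have fresh: "x \<noteq> y" "y \<noteq> e" "x \<noteq> e" "x \<notin># M" "y \<notin># M" "e \<notin># M" 
    "y @ x \<notin># add_mset e M" "x @ e \<notin># add_mset y M"
    unfolding us vs ws by (auto simp: count_eq_zero_iff split: if_splits)
  then have "set (items us) - {x} = insert y (insert e (set_mset M))"
    using set by auto
  moreover have "card (arrangements (insert y (insert e (set_mset M)))) = card (arrangements (set (items vs)))"
    using fresh set(2) by (simp add: card_arrangements)
  ultimately show ?thesis
    using join_blocks[of y e "set_mset M" x] fresh set by simp
qed

end

context stack_sorting begin

section \<open>The potential bounds the average cost\<close>

text \<open>
  By how much the flips made when an item of \<open>u\<close> is on top, summed over its items and both
  orientations, may exceed the decrease of the potential; \<open>us\<close> is the rest of the cycle after \<open>u\<close>.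
\<close>

definition slack :: "'a segment \<Rightarrow> 'a segment list \<Rightarrow> real" where
  "slack u us = (if is_couple u then - (3 - first_couple us - last_couple us) / 6
    else (first_couple us * (3 + first_couple (tl us)) + last_couple us * (3 + last_couple (butlast us))) / 12)"

text \<open>Divided by 24, the last hypothesis says that the 3 flips spent on the two top
  orientations exceed twice the drop in potential by at most \<open>e\<close>.\<close>

lemma step_block_single:
  assumes "valid us" "valid vs" "rev s = s" "z = s @ b \<or> z = b @ s"
    "mset (items us) = add_mset s (add_mset b M)" "mset (items vs) = add_mset z M"
    and IH: "tot vs \<le> number vs * (potential vs + 5)"
    and "36 * 2 + 48 * potential vs \<le> 48 * potential us + 24 * e"
  shows "top_cost us b \<le> number vs * (2 * (potential us + 5) + e)" 
    "top_cost us s \<le> number vs * (2 * (potential us + 5) + e)"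
proof -
  have "3 * number vs + 2 * tot vs \<le> number vs * (3 + 2 * (potential vs + 5))"
    using IH by (simp add: algebra_simps)
  also have "\<dots> \<le> number vs * (2 * (potential us + 5) + e)"
    using assms(8) by (intro mult_left_mono) auto
  finally show "top_cost us b \<le> number vs * (2 * (potential us + 5) + e)" 
    "top_cost us s \<le> number vs * (2 * (potential us + 5) + e)"
    using merge_block_single[OF assms(1-6)] by linarith+
qed

lemma slack_ge:
  assumes "\<not> is_couple u"
  shows "first_couple us * (3 + first_couple (tl us)) \<le> 12 * slack u us"
    and "last_couple us * (3 + last_couple (butlast us)) \<le> 12 * slack u us"
    and "0 \<le> slack u us"
  using assms by (simp_all add: slack_def first_couple_def last_couple_def)

lemma length_eq_if_mset: "mset xs = add_mset a (add_mset b M) \<Longrightarrow> mset ys = add_mset c M \<Longrightarrow> Suc (length ys) = length xs"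
  by (metis size_mset size_add_mset)

text \<open>A couple joins its own halves. A block prefers its own widows, then a couple or widow
  just before it, then one just after it, and otherwise chooses between two neighbouring blocks.
  Losing a widow lowers the potential by 36/24 = 3/2 and losing a block by 42/24 = 7/4, exactly the
  flips spent; only joins involving couples produce slack.\<close>

lemma segment_step:
  fixes us :: "'a segment list"
  assumes us_def: "us = u # rest"
  assumes valid: "valid us" and len: "length (items us) = Suc k" "2 \<le> k"
    and IH: "\<And>vs. valid vs \<Longrightarrow> length (items vs) = k \<Longrightarrow> tot vs \<le> number vs * (potential vs + 5)"
  shows "(\<Sum>x\<leftarrow>segment_items u. top_cost us x) \<le>
    2 ^ k * fact k * (2 * length (segment_items u) * (potential us + 5) + slack u rest)"
proof -
  define a :: real where "a = 2 ^ k * fact k"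
  have number: "number vs = a" if "valid vs" "length (items vs) = k" for vs
    using number_eq[OF that(1)] that(2) by (simp add: a_def)
  have single: "top_cost us b \<le> a * (2 * (potential us + 5) + e) \<and> top_cost us s \<le> a * (2 * (potential us + 5) + e)"
    if "concat (items vs) = concat (items us) \<or> valid vs" "[] \<notin> set (items vs)" "rev s = s" "z = s @ b \<or> z = b @ s"
    "mset (items us) = add_mset s (add_mset b M)" "mset (items vs) = add_mset z M"
    "36 * 2 + 48 * potential vs \<le> 48 * potential us + 24 * e" for vs s b z M e
  proof -
    have "valid vs" using that valid valid_merge by blast
    moreover have "length (items vs) = k"
      using length_eq_if_mset[OF that(5,6)] len(1) by simp
    ultimately show ?thesis
      using step_block_single[OF valid \<open>valid vs\<close> that(3-6) IH that(7)] number by simp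
  qed
  have nonempty: "[] \<notin> set (items us)" using valid by (simp add: valid_def)
  have rotated: "valid (rest @ [u])" using valid valid_append_commute[of "[u]" rest] by (simp add: us_def)
  show ?thesis
  proof (cases u)
    case (Couple x y)
    let ?vs = "Block None [x, y] None # rest"
    have "rest \<noteq> []" using len by (auto simp: us_def Couple)
    have vs: "valid ?vs" using valid nonempty by (auto simp: valid_def us_def Couple)
    have "length (items ?vs) = k" using len by (simp add: us_def Couple)
    note vs = vs this
    have "top_cost us [x] + top_cost us [y] \<le> 4 * number ?vs + 4 * tot ?vs"
      by (rule merge_singles[OF valid vs(1), of _ _ "mset (items rest)"]) (simp_all add: us_def Couple)
    also have "\<dots> \<le> 4 * a + 4 * (a * (potential ?vs + 5))"
      using IH[OF vs] number[OF vs] by simp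
    \<comment> \<open>The potential drops by
      \<open>(27 - first_couple rest - last_couple rest) / 24\<close>; four flips minus four times
      this drop is the slack.\<close>
    also have "\<dots> = a * (4 * (potential us + 5) + slack u rest)"
      using \<open>rest \<noteq> []\<close> 
      by (simp add: us_def Couple potential_Block potential_Couple slack_def field_simps)
    finally show ?thesis by (simp add: Couple a_def)
  next
    case u: (Block l b r)
    have widow_l: "top_cost us b \<le> a * (2 * (potential us + 5)) \<and> top_cost us [w] \<le> a * (2 * (potential us + 5))"
      if "l = Some w" for w
      using single[of "Block None (w # b) r # rest" "[w]" "w # b" b "mset (widow r) + mset (items rest)" 0] nonempty
      by (simp add: us_def u that potential_Block)
    have widow_r: "top_cost us b \<le> a * (2 * (potential us + 5)) \<and> top_cost us [w] \<le> a * (2 * (potential us + 5))"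
      if "r = Some w" for w
      using single[of "Block l (b @ [w]) None # rest" "[w]" "b @ [w]" b "mset (widow l) + mset (items rest)" 0] nonempty
      by (simp add: us_def u that potential_Block)
    have "a \<ge> 0" by (simp add: a_def)
    have s0: "0 \<le> a * slack u rest" using \<open>a \<ge> 0\<close> slack_ge(3)[of u rest] by (simp add: u)
    have weaken: "top_cost us b \<le> a * (2 * (potential us + 5)) \<Longrightarrow> top_cost us b \<le> a * (2 * (potential us + 5) + slack u rest)"
      using s0 by (simp add: algebra_simps)
    have block: "top_cost us b \<le> a * (2 * (potential us + 5) + slack u rest)" if lr: "l = None" "r = None"
    proof -
      have "rest \<noteq> []" using len by (auto simp: us_def u lr)
      then obtain mid v where rest: "rest = mid @ [v]" by (cases rest rule: rev_cases) auto
      show ?thesis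
      proof (cases v)
        case v: (Couple x y)
        \<comment> \<open>The block takes the near half \<open>y\<close>, and \<open>x\<close>
          becomes its widow. The weights drop by only 69 - 36 = 33, and the couple's adjacency
          discount is lost as well: this is the positive slack of a block.\<close>
        let ?vs = "Block (Some x) (y # b) None # mid"
        have "valid ?vs"
          using rotated valid_append_commute[of mid "[v, u]"] nonempty
          by (auto simp: rest v u lr us_def valid_def)
        moreover have "36 * 2 + 48 * potential ?vs \<le> 48 * potential us + 24 * slack u rest"
          using slack_ge(2)[of u rest] by (simp add: us_def u lr rest v potential_Block adjacent_couples_snoc field_simps)
        ultimately show ?thesis
          using single[of ?vs "[y]" "y # b" b "add_mset [x] (mset (items mid))" "slack u rest"] nonempty
          by (simp add: us_def u lr rest v)
      next
        case v: (Block l' b' r')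
        show ?thesis
        proof (cases r')
          case (Some w)
          let ?vs = "Block None (w # b) None # mid @ [Block l' b' None]"
          have "valid (Block l' b' None # Block None (w # b) None # mid)"
            using rotated valid_append_commute[of mid "[v, u]"] nonempty
            by (auto simp: rest v u lr us_def valid_def Some)
          then have "valid ?vs" using valid_append_commute[of "[Block l' b' None]" "Block None (w # b) None # mid"] by simp
          moreover have "36 * 2 + 48 * potential ?vs \<le> 48 * potential us"
            by (auto simp: us_def u lr rest v Some potential_Block adjacent_couples_snoc)
          ultimately show ?thesis
            using single[of ?vs "[w]" "w # b" b "mset (widow l') + add_mset b' (mset (items mid))" 0] nonempty
            by (intro weaken) (simp add: us_def u lr rest v Some)
        next
          case None
          from \<open>rest \<noteq> []\<close> obtain w tail where rest': "rest = w # tail" by (cases rest) auto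
          show ?thesis
          proof (cases w)
            case w: (Couple x y)
            let ?vs = "Block None (b @ [x]) (Some y) # tail"
            have "36 * 2 + 48 * potential ?vs \<le> 48 * potential us + 24 * slack u rest"
              using slack_ge(1)[of u rest] by (simp add: us_def u lr rest' w potential_Block adjacent_couples_Cons field_simps)
            then show ?thesis
              using single[of ?vs "[x]" "b @ [x]" b "add_mset [y] (mset (items tail))" "slack u rest"] nonempty
              by (simp add: us_def u lr rest' w)
          next
            case w: (Block l'' b'' r'')
            show ?thesis
            proof (cases l'')
              case (Some c)
              let ?vs = "Block None (b @ [c]) None # Block None b'' r'' # tail"
              have "36 * 2 + 48 * potential ?vs \<le> 48 * potential us"
                by (simp add: us_def u lr rest' w Some potential_Block adjacent_couples_Cons field_simps)
              then show ?thesis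
                using single[of ?vs "[c]" "b @ [c]" b "add_mset b'' (mset (widow r'') + mset (items tail))" 0] nonempty
                by (intro weaken) (simp add: us_def u lr rest' w Some)
            next
              case None'': None
              \<comment> \<open>Otherwise the same block would be the neighbour on both sides and
                there would be only two items.\<close>
              have "tail \<noteq> []"
              proof
                assume "tail = []"
                then have "w = v" "mid = []" using rest rest' by (auto simp: append_eq_Cons_conv)
                then show False using len rest None None'' v w by (simp add: us_def u lr)
              qed
              then obtain mid' where tail: "tail = mid' @ [Block l' b' None]"
                using rest rest' v None by (cases tail rule: rev_cases) auto
              \<comment> \<open>The two possible outcomes, joining the preceding or the following
                block; each lowers the potential by 7/4.\<close>
              let ?vs = "Block l' (b' @ b) None # Block None b'' r'' # mid'"
              let ?ws = "Block None (b @ b'') r'' # mid' @ [Block l' b' None]"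
              have "valid (Block l' b' None # u # w # mid')"
                using valid valid_append_commute[of "u # w # mid'" "[Block l' b' None]"] by (simp add: us_def rest' tail)
              then have vs: "valid ?vs" "length (items ?vs) = k" 
                using nonempty len(1) by (auto simp: us_def rest' tail u lr w None'' valid_def)
              have ws: "valid ?ws" "length (items ?ws) = k" 
                using valid nonempty len(1) by (auto simp: us_def rest' tail u lr w None'' valid_def)
              have "top_cost us b \<le> 7 / 2 * number ?vs + tot ?vs + tot ?ws"
                by (rule merge_blocks[OF valid vs(1) ws(1), of b' _ b'' "mset (widow l') + mset (widow r'') + mset (items mid')"])
                  (simp_all add: us_def rest' tail u lr w None'')
              also have "\<dots> \<le> 7 / 2 * a + a * (potential ?vs + 5) + a * (potential ?ws + 5)"
                using IH[OF vs] number[OF vs] IH[OF ws] number[OF ws] by simp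
              also have "\<dots> = a * (2 * (potential us + 5))"
                by (simp add: us_def rest' tail u lr w None'' potential_Block adjacent_couples_Cons adjacent_couples_snoc 
                    field_simps)
              finally show ?thesis by (rule weaken)
            qed
          qed
        qed
      qed
    qed
    show ?thesis
      unfolding a_def[symmetric]
      using widow_l widow_r block s0 by (cases l; cases r) (force simp: u algebra_simps)+
  qed
qed

end

section \<open>Balancing the slack around the cycle\<close>

lemma sum_shift_periodic:
  fixes f :: "nat \<Rightarrow> real"
  assumes "\<And>i. f (i + m) = f i"
  shows "(\<Sum>i<m. f (i + c)) = (\<Sum>i<m. f i)"
proof (induction c)
  case (Suc c)
  have "(\<Sum>i<m. f (i + Suc c)) + f c = (\<Sum>i<Suc m. f (i + c))"
    by (subst sum.lessThan_Suc_shift) (simp add: add.commute)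
  also have "\<dots> = (\<Sum>i<m. f (i + c)) + f c" using assms[of c] by (simp add: add.commute)
  finally show ?case using Suc by simp
qed simp

text \<open>
  With \<open>p i\<close> indicating that the \<open>i\<close>-th segment is a couple, the first summand is what a couple saves
  and the second what a block loses by breaking couples next to it. Charged to the couples, the
  losses are covered. The offset \<open>2 * m - 2\<close> stands for \<open>-2\<close>.
\<close>

lemma sum_periodic_charges:
  fixes p :: "nat \<Rightarrow> real"
  assumes per: "\<And>i. p (i + m) = p i" and p01: "\<And>i. 0 \<le> p i" and "m \<ge> 1"
  shows "(\<Sum>i<m. - 2 * p i * (3 - p (i + (m - 1)) - p (i + 1)) +
    (1 - p i) * (p (i + 1) * (3 + p (i + 2)) + p (i + (m - 1)) * (3 + p (i + (2 * m - 2))))) \<le> 0"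
proof -
  define l r where "l = (\<lambda>i. p (i + (m - 1)))" and "r = (\<lambda>i. p (i + 1))"
  define f g where "f = (\<lambda>i. (1 - p i) * (p (i + 1) * (3 + p (i + 2))))"
    and "g = (\<lambda>i. (1 - p i) * (p (i + (m - 1)) * (3 + p (i + (2 * m - 2)))))"
  have pm: "p (m + i) = p i" "p (i + m + j) = p (i + j)" for i j 
    using per[of i] per[of "i + j"] by (simp_all add: add_ac)
  \<comment> \<open>A cyclic shift by one moves the charge from a block to the couple after it;
    \<open>g\<close> likewise moves to the couple before.\<close>
  have f: "(\<Sum>i<m. f i) = (\<Sum>i<m. (1 - l i) * (p i * (3 + r i)))"
  proof -
    have "f (i + m) = f i" for i using pm(2)[of i 1] pm(2)[of i 2] per[of i] by (simp add: f_def add_ac)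
    then have "(\<Sum>i<m. f i) = (\<Sum>i<m. f (i + (m - 1)))" by (rule sum_shift_periodic[symmetric])
    moreover have "f (i + (m - 1)) = (1 - l i) * (p i * (3 + r i))" for i
    proof -
      have "i + (m - 1) + 1 = i + m" "i + (m - 1) + 2 = (i + 1) + m" using \<open>m \<ge> 1\<close> by simp_all
      then show ?thesis unfolding f_def l_def r_def using per by metis
    qed
    ultimately show ?thesis by (simp only:)
  qed
  have g: "(\<Sum>i<m. g i) = (\<Sum>i<m. (1 - r i) * (p i * (3 + l i)))"
  proof -
    have "g (i + m) = g i" for i 
      using pm(2)[of i "m - 1"] pm(2)[of i "2 * m - 2"] per[of i] by (simp add: g_def add_ac)
    then have "(\<Sum>i<m. g i) = (\<Sum>i<m. g (i + 1))" by (rule sum_shift_periodic[symmetric])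
    moreover have "g (i + 1) = (1 - r i) * (p i * (3 + l i))" for i
    proof -
      have "i + 1 + (m - 1) = i + m" "i + 1 + (2 * m - 2) = i + (m - 1) + m" using \<open>m \<ge> 1\<close> by simp_all
      then show ?thesis unfolding g_def l_def r_def using per by metis
    qed
    ultimately show ?thesis by (simp only:)
  qed
  have "(\<Sum>i<m. - 2 * p i * (3 - l i - r i) + (f i + g i)) = 
      (\<Sum>i<m. - 2 * p i * (3 - l i - r i)) + ((\<Sum>i<m. f i) + (\<Sum>i<m. g i))"
    by (simp only: sum.distrib)
  \<comment> \<open>The coefficient of \<open>p i\<close> is -6 + 2l + 2r + (1-l)(3+r) + (1-r)(3+l)
    = -2lr.\<close>
  also have "\<dots> = (\<Sum>i<m. - 2 * p i * l i * r i)"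
    unfolding f g by (simp only: sum.distrib[symmetric]) (rule sum.cong, simp_all add: algebra_simps)
  also have "\<dots> \<le> 0" 
    using p01 by (intro sum_nonpos) (simp add: l_def r_def)
  finally show ?thesis by (simp add: f_def g_def l_def r_def algebra_simps)
qed

lemma arrangements_two_cases:
  assumes "q \<in> arrangements {x, y}" "x \<noteq> y"
  obtains b c where "q = [(b, x), (c, y)] \<or> q = [(b, y), (c, x)]"
proof -
  have q: "distinct (map snd q)" "snd ` set q = {x, y}" using assms by (auto simp: arrangements_def)
  have "length q = 2" using distinct_card[OF q(1)] q(2) assms(2) by simp
  then obtain u v where "q = [u, v]" by (auto simp: numeral_2_eq_2 length_Suc_conv)
  with q that show ?thesis by (cases u; cases v) (auto simp: doubleton_eq_iff)
qed

section \<open>The initial pairing and its potential\<close>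

fun pair_up :: "'a list \<Rightarrow> 'a segment list" where
  "pair_up (x # y # xs) = Couple x y # pair_up xs"
| "pair_up [x] = [Block None [x] None]"
| "pair_up [] = []"

lemma items_pair_up: "items (pair_up xs) = map (\<lambda>x. [x]) xs"
  by (induction xs rule: pair_up.induct) auto

text \<open>A couple and one adjacency cost 69 - 1 = 2 * 34. The last couple lacks an adjacency, and
  an odd pancake costs 42 = 34 + 8, which accounts for the 9.\<close>

lemma weight_pair_up: "sum_list (map weight (pair_up xs)) - adjacent_couples (pair_up xs) \<le> 34 * length xs + 9"
proof (induction xs rule: pair_up.induct)
  case (1 x y xs)
  show ?case
  proof (cases xs rule: pair_up.cases)
    case (1 x' y' xs')
    with "1.IH" show ?thesis by (simp add: adjacent_couples_Cons)
  qed (auto simp: adjacent_couples_Cons)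
qed auto

lemma potential_pair_up: "potential (pair_up xs) \<le> 17 / 12 * length xs + 1"
proof -
  have "adjacent_couples (pair_up xs) \<le> adjacent_couples (pair_up xs @ [hd (pair_up xs)])"
    by (simp add: adjacent_couples_snoc last_couple_def)
  then show ?thesis using weight_pair_up[of xs] by (simp add: potential_def)
qed

text \<open>Each segment weighs at least 42 and loses at most 1 to adjacency. Hence
  \<open>potential us + 5\<close> leaves room for six flips in the base case.\<close>

lemma potential_ge_1:
  assumes "us \<noteq> []"
  shows "1 \<le> potential us"
proof -
  have "42 * real (length us) \<le> sum_list (map weight us)"
  proof (induction us)
    case (Cons u us)
    then show ?case by (cases u) auto
  qed simp
  moreover have "adjacent_couples (us @ [v]) \<le> length us" for v
  proof (induction us)
    case (Cons u us)
    then show ?case by (simp add: adjacent_couples_Cons first_couple_def)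
  qed simp
  then have "adjacent_couples (us @ [hd us]) \<le> length us" .
  moreover have "1 \<le> real (length us)" using assms by (cases us) auto
  ultimately have "24 \<le> sum_list (map weight us) - adjacent_couples (us @ [hd us])"
    using \<open>42 * real (length us) \<le> sum_list (map weight us)\<close> by argo
  then show ?thesis by (simp add: potential_def)
qed

text \<open>Turning a one-pancake block changes nothing, so every stack is the layout of
  \<open>2 ^ card S\<close> arrangements.\<close>

lemma sum_arrangements_singletons:
  assumes "finite S"
  shows "(\<Sum>q\<in>arrangements ((\<lambda>x. [x]) ` S). f (layout q)) = 2 ^ card S * (\<Sum>xs\<in>permutations_of_set S. f xs :: real)"
proof -
  let ?B = "{bs :: bool list. set bs \<subseteq> UNIV \<and> length bs = card S}"
  have len: "length xs = card S" if "xs \<in> permutations_of_set S" for xs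
    using that by (simp add: length_finite_permutations_of_set)
  have layout: "length bs = length xs \<Longrightarrow> layout (zip bs (map (\<lambda>x. [x]) xs)) = xs" for bs :: "bool list" and xs :: "'a list"
    by (induction bs xs rule: list_induct2) (auto simp: orient_def)
  have "(\<Sum>q\<in>arrangements ((\<lambda>x. [x]) ` S). f (layout q)) = (\<Sum>(xs, bs)\<in>permutations_of_set S \<times> ?B. f xs)"
  proof (rule sum.reindex_bij_witness[symmetric, where j = "\<lambda>(xs, bs). zip bs (map (\<lambda>x. [x]) xs)" 
        and i = "\<lambda>q. (map (hd \<circ> snd) q, map fst q)"])
    fix a assume "a \<in> permutations_of_set S \<times> ?B"
    then obtain xs bs where a: "a = (xs, bs)" "set xs = S" "distinct xs" "length bs = length xs"
      by (cases a) (use len permutations_of_setD in fastforce)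
    show "(case a of (xs, bs) \<Rightarrow> zip bs (map (\<lambda>x. [x]) xs)) \<in> arrangements ((\<lambda>x. [x]) ` S)"
    proof -
      have ms: "map snd (zip bs (map (\<lambda>x. [x]) xs)) = map (\<lambda>x. [x]) xs" using a by simp
      have "snd ` set (zip bs (map (\<lambda>x. [x]) xs)) = (\<lambda>x. [x]) ` S"
        unfolding set_map[symmetric] ms using a by simp
      moreover have "distinct (map snd (zip bs (map (\<lambda>x. [x]) xs)))"
        unfolding ms using a by (simp add: distinct_map inj_on_def)
      ultimately show ?thesis using a by (simp add: arrangements_def)
    qed
    show "f (layout (case a of (xs, bs) \<Rightarrow> zip bs (map (\<lambda>x. [x]) xs))) = (case a of (xs, bs) \<Rightarrow> f xs)"
      using a layout by simp
    show "(map (hd \<circ> snd) (case a of (xs, bs) \<Rightarrow> zip bs (map (\<lambda>x. [x]) xs)), 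
      map fst (case a of (xs, bs) \<Rightarrow> zip bs (map (\<lambda>x. [x]) xs))) = a"
      using a by (simp add: comp_def flip: map_map[of hd snd, unfolded comp_def])
  next
    fix q assume "q \<in> arrangements ((\<lambda>x. [x]) ` S)"
    then have q: "distinct (map snd q)" "set (map snd q) = (\<lambda>x. [x]) ` S" by (auto simp: arrangements_def)
    have sing: "map (\<lambda>x. [x]) (map (hd \<circ> snd) q) = map snd q"
    proof -
      have "[hd b] = b" if "b \<in> set (map snd q)" for b using that unfolding q(2) by auto
      then have "map (\<lambda>b. [hd b]) (map snd q) = map snd q" by (rule map_idI)
      then show ?thesis by (simp add: comp_def)
    qed
    have "distinct (map (hd \<circ> snd) q)" using q(1) sing by (metis distinct_map)
    moreover have "set (map (hd \<circ> snd) q) = S"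
    proof -
      have "set (map (hd \<circ> snd) q) = hd ` set (map snd q)" by (simp add: image_comp)
      then show ?thesis unfolding q(2) by (simp add: image_comp comp_def)
    qed
    moreover have "length q = card S"
      using distinct_card[OF q(1)] q(2) by (simp add: card_image inj_on_def)
    ultimately show "(map (hd \<circ> snd) q, map fst q) \<in> permutations_of_set S \<times> ?B"
      unfolding permutations_of_set_def by simp
    show "(case (map (hd \<circ> snd) q, map fst q) of (xs, bs) \<Rightarrow> zip bs (map (\<lambda>x. [x]) xs)) = q"
      by (simp only: prod.case sing zip_map_fst_snd)
  qed
  also have "\<dots> = (\<Sum>xs\<in>permutations_of_set S. \<Sum>bs\<in>?B. f xs)"
    by (rule sum.cartesian_product[symmetric])
  also have "\<dots> = 2 ^ card S * (\<Sum>xs\<in>permutations_of_set S. f xs)"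
    using card_lists_length_eq[of "UNIV :: bool set" "card S"] by (simp add: sum_distrib_left)
  finally show ?thesis .
qed

section \<open>Induction on the number of items\<close>

context stack_sorting begin

text \<open>Rewrites the slack with cyclic indices. Cycles of one or two segments are separate
  because there the indices coincide; a lone segment with three items must be a block.\<close>

lemma slack_le:
  fixes w :: "'a segment list"
  assumes w: "w = u # us" and "length (items w) \<ge> 3"
  defines "p \<equiv> \<lambda>j. of_bool (is_couple (w ! (j mod length w))) :: real"
  defines "m \<equiv> length w"
  shows "12 * slack u us \<le> - 2 * p 0 * (3 - p (m - 1) - p 1) + 
    (1 - p 0) * (p 1 * (3 + p 2) + p (m - 1) * (3 + p (2 * m - 2)))"
proof -
  consider "us = []" | v where "us = [v]" | v mid v' where "us = v # mid @ [v']"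
    by (metis rev_cases neq_Nil_conv)
  then show ?thesis
  proof cases
    case 1
    then have "\<not> is_couple u" using assms(2) by (cases u) (auto simp: w)
    then show ?thesis using 1 by (simp add: slack_def p_def m_def w)
  next
    case (2 v)
    then show ?thesis by (auto simp: slack_def p_def m_def w)
  next
    case (3 v mid v')
    have m: "m = length mid + 3" by (simp add: m_def w 3)
    have "w ! (m - 1) = v'" by (simp add: w 3 m nth_append)
    then have 1: "p (m - 1) = of_bool (is_couple v')" by (simp add: p_def m_def[symmetric] m)
    have "(2 * m - 2) mod m = m - 2"
    proof -
      have "2 * m - 2 = m + (m - 2)" using m by simp
      then show ?thesis unfolding \<open>2 * m - 2 = m + (m - 2)\<close> mod_add_self1 using m by simp
    qed
    moreover have "w ! (m - 2) = last (v # mid)"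
      by (simp add: w 3 m nth_append last_conv_nth)
    ultimately have 2: "p (2 * m - 2) = of_bool (is_couple (last (v # mid)))"
      unfolding p_def m_def[symmetric] by simp
    have "w ! 2 = hd (mid @ [v'])" by (cases mid) (simp_all add: w 3)
    then have 4: "p 2 = of_bool (is_couple (hd (mid @ [v'])))" by (simp add: p_def m_def[symmetric] m)
    have "p 0 = of_bool (is_couple u)" "p 1 = of_bool (is_couple v)"
      by (simp_all add: p_def w 3)
    then show ?thesis unfolding 1 2 4
      by (auto simp: slack_def 3 first_couple_def last_couple_def)
  qed
qed

text \<open>Condition on the top item, group items by segment, and rotate each segment to the front,
  where \<open>segment_step\<close> applies; the slacks sum to at most zero.\<close>

lemma total_step:
  assumes valid: "valid us" and len: "length (items us) = Suc k" "2 \<le> k"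
    and IH: "\<And>vs. valid vs \<Longrightarrow> length (items vs) = k \<Longrightarrow> tot vs \<le> number vs * (potential vs + 5)"
  shows "tot us \<le> number us * (potential us + 5)"
proof -
  define m where "m = length us"
  define a :: real where "a = 2 ^ k * fact k"
  define rest where "rest = (\<lambda>i. tl (rotate i us))"
  define p :: "nat \<Rightarrow> real" where "p = (\<lambda>j. of_bool (is_couple (us ! (j mod m))))"
  have "us \<noteq> []" using len by auto
  then have "m \<ge> 1" by (cases us) (auto simp: m_def)
  have rot: "rotate i us = us ! i # rest i" if "i < m" for i
    using that rotate_drop_take[of i us] by (simp add: rest_def m_def flip: Cons_nth_drop_Suc)
  have items_rot: "mset (items (rotate i us)) = mset (items us)" for i
  proof -
    have "mset (items (take j us @ drop j us)) = mset (items (drop j us @ take j us))" for j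
      by (simp del: append_take_drop_id)
    from this[of "i mod length us"] show ?thesis by (simp add: rotate_drop_take)
  qed
  have len_rot: "length (items (rotate i us)) = Suc k" for i
    using items_rot[of i] len(1) by (metis size_mset)
  have "tot us = (\<Sum>x\<leftarrow>items us. top_cost us x)"
    using total_by_top[of "set (items us)"] len distinct_items[OF valid] 
    by (simp add: sum_list_distinct_conv_sum_set) force
  also have "\<dots> = (\<Sum>u\<leftarrow>us. \<Sum>x\<leftarrow>segment_items u. top_cost us x)"
  proof -
    have "(\<Sum>x\<leftarrow>items vs. f x) = (\<Sum>u\<leftarrow>vs. \<Sum>x\<leftarrow>segment_items u. f x)" for f :: "_ \<Rightarrow> real" and vs :: "'a segment list"
      by (induction vs) auto
    then show ?thesis .
  qed
  also have "\<dots> = (\<Sum>i<m. \<Sum>x\<leftarrow>segment_items (us ! i). top_cost us x)"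
    by (simp add: sum_list_sum_nth m_def atLeast0LessThan)
  also have "\<dots> \<le> (\<Sum>i<m. a * (2 * length (segment_items (us ! i)) * (potential us + 5) + slack (us ! i) (rest i)))"
  proof (rule sum_mono)
    fix i assume "i \<in> {..<m}"
    then have i: "rotate i us = us ! i # rest i" using rot by simp
    have "set (items (rotate i us)) = set (items us)" using items_rot[of i] by (metis set_mset_mset)
    then show "(\<Sum>x\<leftarrow>segment_items (us ! i). top_cost us x) \<le> 
        a * (2 * length (segment_items (us ! i)) * (potential us + 5) + slack (us ! i) (rest i))"
      using segment_step[OF i valid_rotate[OF valid] len_rot len(2) IH] by (simp add: potential_rotate a_def)
  qed
  also have "\<dots> = a * (2 * (\<Sum>i<m. length (segment_items (us ! i))) * (potential us + 5) + (\<Sum>i<m. slack (us ! i) (rest i)))"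
    by (simp add: sum_distrib_left sum_distrib_right sum.distrib algebra_simps)
  also have "(\<Sum>i<m. length (segment_items (us ! i))) = Suc k"
    using len(1) by (simp add: items_def length_concat sum_list_sum_nth m_def atLeast0LessThan comp_def)
  also have "(\<Sum>i<m. slack (us ! i) (rest i)) \<le> 0"
  proof -
    have "(\<Sum>i<m. 12 * slack (us ! i) (rest i)) \<le> (\<Sum>i<m. - 2 * p i * (3 - p (i + (m - 1)) - p (i + 1)) +
      (1 - p i) * (p (i + 1) * (3 + p (i + 2)) + p (i + (m - 1)) * (3 + p (i + (2 * m - 2)))))"
    proof (rule sum_mono)
      fix i assume "i \<in> {..<m}"
      then have i: "i < m" by simp
      have p: "of_bool (is_couple (rotate i us ! (j mod m))) = p (i + j)" for j
        using \<open>us \<noteq> []\<close> by (simp add: p_def m_def nth_rotate mod_add_right_eq)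
      show "12 * slack (us ! i) (rest i) \<le> - 2 * p i * (3 - p (i + (m - 1)) - p (i + 1)) +
        (1 - p i) * (p (i + 1) * (3 + p (i + 2)) + p (i + (m - 1)) * (3 + p (i + (2 * m - 2))))"
        using slack_le[OF rot[OF i]] len_rot[of i] len(2) unfolding length_rotate m_def[symmetric] p by simp
    qed
    also have "\<dots> \<le> 0"
      by (rule sum_periodic_charges) (use \<open>m \<ge> 1\<close> in \<open>auto simp: p_def\<close>)
    finally show ?thesis by (simp flip: sum_distrib_left)
  qed
  finally have "tot us \<le> a * (2 * Suc k * (potential us + 5))"
    by (simp add: a_def)
  \<comment> \<open>The factor \<open>2 * Suc k\<close> counts the choices of the top item and its
    orientation.\<close>
  also have "\<dots> = number us * (potential us + 5)"
    using number_eq[OF valid] by (simp add: a_def len(1))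
  finally show ?thesis .
qed

text \<open>A rotation swaps two pieces: reverse the first, reverse everything, reverse the new
  first piece.\<close>

lemma sort_rotated: "d (rotate k target) \<le> 3"
proof -
  obtain A B where AB: "target = A @ B" "rotate k target = B @ A"
    using rotate_drop_take append_take_drop_id by metis
  have "d (B @ A) \<le> 1 + d (rev B @ A)" "d (rev B @ A) \<le> 1 + d (rev A @ B)" "d (rev A @ B) \<le> 1 + d (A @ B)"
    using flip[of B A] flip[of "rev B @ A" "[]"] flip[of "rev A" B] by simp_all
  then show ?thesis using AB sorted by simp
qed

text \<open>Every order and orientation is at most two flips away from \<open>X @ Y\<close> or
  \<open>Y @ X\<close>, both of which are rotations of \<open>target\<close>.\<close>

lemma sort_two_blocks:
  assumes "X @ Y = rotate k target"
  shows "d (orient (b, X) @ orient (c, Y)) \<le> 6" "d (orient (b, Y) @ orient (c, X)) \<le> 6"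
proof -
  have XY: "d (X @ Y) \<le> 3" and YX: "d (Y @ X) \<le> 3"
    using assms sort_rotated[of k] sort_rotated[of "length X + k"] by (metis rotate_append rotate_rotate)+
  have 1: "d (rev X @ Y) \<le> 4" "d (rev Y @ X) \<le> 4" "d (rev Y @ rev X) \<le> 4" "d (rev X @ rev Y) \<le> 4"
    using XY YX flip[of "rev X" Y] flip[of "rev Y" X] flip[of "rev Y @ rev X" "[]"] flip[of "rev X @ rev Y" "[]"]
    by simp_all
  have "d (Y @ rev X) \<le> 5" "d (X @ rev Y) \<le> 5"
    using 1 flip[of Y "rev X"] flip[of X "rev Y"] by simp_all
  with 1 XY YX show "d (orient (b, X) @ orient (c, Y)) \<le> 6" "d (orient (b, Y) @ orient (c, X)) \<le> 6"
    by (cases b; cases c; simp add: orient_def)+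
qed

lemma total_base:
  assumes valid: "valid us" and len: "length (items us) = Suc k" "k \<le> 1"
  shows "tot us \<le> number us * (potential us + 5)"
proof -
  obtain j where j: "concat (items us) = rotate j target" using valid by (auto simp: valid_def)
  have "d (layout q) \<le> 6" if q: "q \<in> arrangements (set (items us))" for q
  proof (cases k)
    case 0
    with len obtain x where x: "items us = [x]" by (auto simp: length_Suc_conv)
    have q': "distinct (map snd q)" "snd ` set q = {x}" using q by (simp_all add: arrangements_def x)
    have "length q = 1" using distinct_card[OF q'(1)] q'(2) by simp
    then obtain u where "q = [u]" by (auto simp: length_Suc_conv)
    with q'(2) obtain b where "q = [(b, x)]" by (cases u) auto
    \<comment> \<open>A single item is treated as two blocks of which the second is empty.\<close>
    then show ?thesis using sort_two_blocks(1)[of x "[]" j b True] j x by (simp add: orient_def)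
  next
    case (Suc k')
    with len obtain x y where xy: "items us = [x, y]" by (auto simp: length_Suc_conv)
    then have "x \<noteq> y" using distinct_items[OF valid] by simp
    then obtain b c where "q = [(b, x), (c, y)] \<or> q = [(b, y), (c, x)]"
      using arrangements_two_cases[of q x y] q unfolding xy by (metis empty_set list.simps(15))
    moreover have "x @ y = rotate j target" using j xy by simp
    ultimately show ?thesis using sort_two_blocks[of x y j b c] by (elim disjE) simp_all
  qed
  then have "tot us \<le> (\<Sum>q\<in>arrangements (set (items us)). 6)"
    unfolding total_def by (rule sum_mono)
  also have "\<dots> \<le> number us * (potential us + 5)"
  proof -
    have "us \<noteq> []" using len by auto
    then show ?thesis using potential_ge_1[of us] by (simp add: mult_left_mono)
  qed
  finally show ?thesis .
qed

lemma total_le_potential: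
  "valid us \<Longrightarrow> us \<noteq> [] \<Longrightarrow> tot us \<le> number us * (potential us + 5)"
proof (induction "length (items us)" arbitrary: us)
  case 0
  then show ?case by (cases us; cases "hd us") auto
next
  case (Suc k)
  show ?case
  proof (cases "k \<le> 1")
    case True
    then show ?thesis using total_base[of us k] Suc by simp
  next
    case False
    show ?thesis
    proof (rule total_step[of us k])
      fix vs :: "'a segment list"
      assume vs: "valid vs" "length (items vs) = k"
      then have "vs \<noteq> []" using False by auto
      with vs show "tot vs \<le> number vs * (potential vs + 5)" using Suc(1)[of vs] by simp
    qed (use Suc False in auto)
  qed
qed

theorem sum_permutations_le:
  assumes "target \<noteq> []"
  shows "(\<Sum>xs\<in>permutations_of_set (set target). d xs) \<le> fact (length target) * (17 / 12 * length target + 6)"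
proof -
  let ?us = "pair_up target" and ?n = "length target"
  have "concat (items ?us) = rotate 0 target" by (simp add: items_pair_up)
  then have valid: "valid ?us" unfolding valid_def by (intro conjI exI[of _ 0]) (auto simp: items_pair_up)
  have "?us \<noteq> []" using assms by (cases target rule: pair_up.cases) auto
  have set: "set (items ?us) = (\<lambda>x. [x]) ` set target" by (simp add: items_pair_up)
  have "card (set target) = ?n" using distinct_target by (simp add: distinct_card)
  then have "2 ^ ?n * (\<Sum>xs\<in>permutations_of_set (set target). d xs) = tot ?us"
    unfolding total_def set using sum_arrangements_singletons[of "set target" d] by simp
  also have "\<dots> \<le> number ?us * (potential ?us + 5)"
    using total_le_potential[OF valid \<open>?us \<noteq> []\<close>] .
  also have "\<dots> \<le> number ?us * (17 / 12 * ?n + 6)"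
    using potential_pair_up[of target] by (intro mult_left_mono) auto
  also have "\<dots> = 2 ^ ?n * (fact ?n * (17 / 12 * ?n + 6))"
    using number_eq[OF valid] by (simp add: items_pair_up)
  finally show ?thesis by simp
qed

end

section \<open>Flip distance of stacks\<close>

inductive flips_to :: "'a list \<Rightarrow> 'a list \<Rightarrow> nat \<Rightarrow> bool" for t where
  flips_to_refl: "flips_to t t 0"
| flips_to_step: "flips_to t (rev A @ B) k \<Longrightarrow> flips_to t (A @ B) (Suc k)"

definition flip_distance :: "'a list \<Rightarrow> 'a list \<Rightarrow> nat" where
  "flip_distance t xs = (LEAST k. flips_to t xs k)"

lemma flip_distance_flip: "flip_distance t (A @ B) \<le> Suc (flip_distance t (rev A @ B))"
proof (cases "\<exists>k. flips_to t (rev A @ B) k")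
  case True
  then have "flips_to t (rev A @ B) (flip_distance t (rev A @ B))"
    unfolding flip_distance_def by (rule LeastI_ex)
  then have "flips_to t (A @ B) (Suc (flip_distance t (rev A @ B)))" by (rule flips_to_step)
  then show ?thesis unfolding flip_distance_def[of t "A @ B"] by (rule Least_le)
next
  case False
  moreover have "\<not> flips_to t (A @ B) k" for k
    using False flips_to_step[of t "rev A" B k] by auto
  \<comment> \<open>If \<open>t\<close> is unreachable, both distances are \<open>LEAST\<close> of
    the same empty predicate, so the inequality holds for arbitrary lists.\<close>
  ultimately have "flips_to t (A @ B) = flips_to t (rev A @ B)" by auto
  then show ?thesis by (simp add: flip_distance_def)
qed

lemma stack_sorting_flip_distance:
  assumes "distinct t"
  shows "stack_sorting (\<lambda>xs. real (flip_distance t xs)) t"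
proof
  show "real (flip_distance t (A @ B)) \<le> 1 + real (flip_distance t (rev A @ B))" for A B
    using flip_distance_flip[of t A B] by linarith
  have "flip_distance t t \<le> 0" unfolding flip_distance_def by (rule Least_le) (rule flips_to_refl)
  then show "real (flip_distance t t) = 0" by simp
qed fact

text \<open>Two flips bring \<open>Suc j\<close> to the top and then to its final place. This makes
  the \<open>LEAST\<close> in \<open>flip_distance\<close> attained.\<close>

lemma flips_to_sorted_suffix:
  assumes "xs \<in> permutations_of_set {1..j}" "j \<le> n"
  shows "\<exists>k. flips_to [1..<Suc n] (xs @ [Suc j..<Suc n]) k"
  using assms
proof (induction j arbitrary: xs)
  case 0
  then show ?case using flips_to_refl by auto
next
  case (Suc j)
  then have xs: "set xs = {1..Suc j}" "distinct xs" by (auto dest: permutations_of_setD)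
  then obtain A C where AC: "xs = A @ Suc j # C" by (metis atLeastAtMost_iff le_refl split_list le_add1 plus_1_eq_Suc)
  have "set (rev C @ A) = {1..Suc j} - {Suc j}" using xs unfolding AC by auto
  also have "\<dots> = {1..j}" by auto
  finally have "rev C @ A \<in> permutations_of_set {1..j}"
    using xs(2) unfolding AC by (intro permutations_of_setI) auto
  with Suc obtain k where "flips_to [1..<Suc n] ((rev C @ A) @ [Suc j..<Suc n]) k"
    using Suc_leD by blast
  moreover have "[Suc j..<Suc n] = Suc j # [Suc (Suc j)..<Suc n]"
    using Suc.prems(2) by (simp add: upt_conv_Cons)
  ultimately have "flips_to [1..<Suc n] (rev (Suc j # rev A @ C) @ [Suc (Suc j)..<Suc n]) k"
    by simp
  then have "flips_to [1..<Suc n] (rev (A @ [Suc j]) @ C @ [Suc (Suc j)..<Suc n]) (Suc k)"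
    using flips_to_step by fastforce
  then have "flips_to [1..<Suc n] ((A @ [Suc j]) @ C @ [Suc (Suc j)..<Suc n]) (Suc (Suc k))"
    by (rule flips_to_step)
  then show ?case by (auto simp: AC)
qed

section \<open>From lists back to stacks as functions\<close>

lemma map_flip:
  assumes "map \<pi> [1..<Suc n] = A @ B"
  shows "map (flip (length A) \<pi>) [1..<Suc n] = rev A @ B"
proof (rule nth_equalityI)
  have len: "length A + length B = n" using arg_cong[OF assms, of length] by (simp del: upt_Suc)
  have \<pi>: "\<pi> (Suc j) = (A @ B) ! j" if "j < n" for j
    using that arg_cong[OF assms, of "\<lambda>xs. xs ! j"] by (simp add: nth_append del: upt_Suc)
  show "length (map (flip (length A) \<pi>) [1..<Suc n]) = length (rev A @ B)" using len by simp
  fix j assume "j < length (map (flip (length A) \<pi>) [1..<Suc n])"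
  then have j: "j < n" by (simp del: upt_Suc)
  have "map (flip (length A) \<pi>) [1..<Suc n] ! j = flip (length A) \<pi> (Suc j)"
    using j by (simp del: upt_Suc)
  also have "\<dots> = (rev A @ B) ! j"
  proof (cases "j < length A")
    case True
    then have "\<pi> (length A + 1 - Suc j) = A ! (length A - Suc j)"
    proof -
      have lt: "length A - Suc j < length A" "length A - Suc j < n" using True len by linarith+
      have "Suc (length A - Suc j) = length A + 1 - Suc j" using True by simp
      then show ?thesis using \<pi>[OF lt(2)] lt(1) by (simp add: nth_append)
    qed
    with True show ?thesis by (simp add: flip_def nth_append rev_nth)
  next
    case False
    then show ?thesis using \<pi>[OF j] by (simp add: flip_def nth_append)
  qed
  finally show "map (flip (length A) \<pi>) [1..<Suc n] ! j = (rev A @ B) ! j" .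
qed

lemma sorts_stack_if_flips_to:
  assumes "flips_to [1..<Suc n] (map \<pi> [1..<Suc n]) k" "\<And>j. j \<notin> {1..n} \<Longrightarrow> \<pi> j = j"
  shows "\<exists>is. length is \<le> k \<and> sorts_stack n is \<pi>"
  using assms
proof (induction "map \<pi> [1..<Suc n]" k arbitrary: \<pi> rule: flips_to.induct)
  case flips_to_refl
  then have "\<forall>j\<in>{1..n}. \<pi> j = j" by (metis atLeastAtMost_upt map_eq_conv map_ident)
  with flips_to_refl have "\<pi> = id" by (metis eq_id_iff)
  then have "sorts_stack n [] \<pi>" by (simp add: sorts_stack_def apply_flips_def)
  then show ?case by (intro exI[of _ "[]"]) simp
next
  case (flips_to_step A B k)
  show ?case
  proof (cases "A = []")
    \<comment> \<open>An empty prefix reversal is not a legal flip and is dropped; hence only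
      \<open>length is \<le> k\<close>.\<close>
    case True
    then show ?thesis using flips_to_step by (metis append_Nil le_SucI rev.simps(1))
  next
    case False
    let ?i = "length A"
    have "length A + length B = n" using arg_cong[OF flips_to_step(3), of length] by (simp del: upt_Suc)
    with False have i: "?i \<in> {1..n}" by (cases A) auto
    have "rev A @ B = map (flip ?i \<pi>) [1..<Suc n]" using map_flip[OF flips_to_step(3)[symmetric]] ..
    moreover have "flip ?i \<pi> j = j" if "j \<notin> {1..n}" for j
      using that i flips_to_step(4)[of j] by (auto simp: flip_def)
    ultimately obtain "is" where "length is \<le> k" "sorts_stack n is (flip ?i \<pi>)"
      using flips_to_step(2) by blast
    then have "length (?i # is) \<le> Suc k" "sorts_stack n (?i # is) \<pi>"
      using i by (simp_all add: sorts_stack_def apply_flips_def)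
    then show ?thesis by blast
  qed
qed

lemma map_upt_permutes:
  assumes "\<pi> permutes {1..n}"
  shows "map \<pi> [1..<Suc n] \<in> permutations_of_set {1..n}"
  using permutes_image[OF assms] permutes_inj_on[OF assms]
  by (intro permutations_of_setI) (simp_all add: distinct_map atLeastLessThanSuc_atLeastAtMost del: upt_Suc)

lemma shortest_sorting_sequence:
  assumes "\<pi> permutes {1..n}"
  shows "\<exists>is. sorts_stack n is \<pi> \<and> length is \<le> flip_distance [1..<Suc n] (map \<pi> [1..<Suc n])"
proof -
  have "\<exists>k. flips_to [1..<Suc n] (map \<pi> [1..<Suc n]) k"
    using flips_to_sorted_suffix[OF map_upt_permutes[OF assms] order_refl] by simp
  then have "flips_to [1..<Suc n] (map \<pi> [1..<Suc n]) (flip_distance [1..<Suc n] (map \<pi> [1..<Suc n]))"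
    unfolding flip_distance_def by (rule LeastI_ex)
  then show ?thesis using sorts_stack_if_flips_to assms by (metis permutes_not_in)
qed

lemma sum_flip_distance_le:
  assumes "n \<ge> 1"
  shows "(\<Sum>\<pi> | \<pi> permutes {1..n}. real (flip_distance [1..<Suc n] (map \<pi> [1..<Suc n]))) \<le> fact n * (17 / 12 * n + 6)"
proof -
  interpret stack_sorting "\<lambda>xs. real (flip_distance [1..<Suc n] xs)" "[1..<Suc n]"
    by (rule stack_sorting_flip_distance) simp
  have "inj_on (\<lambda>\<pi>. map \<pi> [1..<Suc n]) {\<pi>. \<pi> permutes {1..n}}"
  proof (rule inj_onI, rule ext)
    fix \<pi> \<sigma> j assume *: "\<pi> \<in> {\<pi>. \<pi> permutes {1..n}}" "\<sigma> \<in> {\<pi>. \<pi> permutes {1..n}}" 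
      "map \<pi> [1..<Suc n] = map \<sigma> [1..<Suc n]"
    then have "\<forall>j\<in>{1..n}. \<pi> j = \<sigma> j" by (metis atLeastAtMost_upt map_eq_conv)
    then show "\<pi> j = \<sigma> j" using * by (metis mem_Collect_eq permutes_not_in)
  qed
  then have "(\<Sum>\<pi> | \<pi> permutes {1..n}. real (flip_distance [1..<Suc n] (map \<pi> [1..<Suc n]))) =
      (\<Sum>xs\<in>(\<lambda>\<pi>. map \<pi> [1..<Suc n]) ` {\<pi>. \<pi> permutes {1..n}}. real (flip_distance [1..<Suc n] xs))"
    by (simp only: sum.reindex comp_def)
  also have "\<dots> \<le> (\<Sum>xs\<in>permutations_of_set {1..n}. real (flip_distance [1..<Suc n] xs))"
    using map_upt_permutes by (intro sum_mono2) (auto simp del: upt_Suc)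
  also have "\<dots> \<le> fact n * (17 / 12 * n + 6)"
  proof -
    have "set [1..<Suc n] = {1..n}" by auto
    from sum_permutations_le[unfolded this] show ?thesis using assms by (simp del: upt_Suc)
  qed
  finally show ?thesis .
qed

theorem theorem4:
  fixes n :: nat
  assumes "n \<ge> 1"
  shows "\<exists>A. randomized_pancake_sort n A \<and>
             average_flips n A \<le> ennreal (17 / 12 * real n + 9)"
proof -
  interpret prob_space random_bits
    unfolding random_bits_def by (intro prob_space_PiM measure_pmf.prob_space_axioms)
  let ?d = "\<lambda>\<pi>. flip_distance [1..<Suc n] (map \<pi> [1..<Suc n])"
  define f where "f = (\<lambda>\<pi>. SOME is. sorts_stack n is \<pi> \<and> length is \<le> ?d \<pi>)"
  have f: "sorts_stack n (f \<pi>) \<pi>" "length (f \<pi>) \<le> ?d \<pi>" if "\<pi> permutes {1..n}" for \<pi>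
    using someI_ex[OF shortest_sorting_sequence[OF that]] by (simp_all add: f_def del: upt_Suc)
  \<comment> \<open>The algorithm is constant in the random bits, so it is measurable and its inner
    expectation is the length itself.\<close>
  define A where "A = (\<lambda>\<pi> (\<omega> :: nat \<Rightarrow> bool). f \<pi>)"
  have "randomized_pancake_sort n A"
    using f(1) by (simp add: randomized_pancake_sort_def A_def)
  moreover have "average_flips n A \<le> ennreal (17 / 12 * real n + 9)"
  proof -
    have "(\<Sum>\<pi> | \<pi> permutes {1..n}. \<integral>\<^sup>+ \<omega>. of_nat (length (A \<pi> \<omega>)) \<partial>random_bits) =
        (\<Sum>\<pi> | \<pi> permutes {1..n}. ennreal (length (f \<pi>)))"
      by (simp add: A_def emeasure_space_1 ennreal_of_nat_eq_real_of_nat)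
    also have "\<dots> \<le> (\<Sum>\<pi> | \<pi> permutes {1..n}. ennreal (?d \<pi>))"
      using f(2) by (intro sum_mono ennreal_leI) auto
    also have "\<dots> = ennreal (\<Sum>\<pi> | \<pi> permutes {1..n}. real (?d \<pi>))"
      by (rule sum_ennreal) simp
    also have "\<dots> \<le> ennreal (fact n * (17 / 12 * n + 6))"
      using sum_flip_distance_le[OF assms] by (rule ennreal_leI)
    finally have "average_flips n A \<le> ennreal (fact n * (17 / 12 * n + 6)) / ennreal (fact n)"
      unfolding average_flips_def 
      by (metis divide_right_mono_ennreal ennreal_of_nat_eq_real_of_nat of_nat_fact)
    also have "\<dots> = ennreal (17 / 12 * n + 6)"
      by (subst divide_ennreal) (simp_all del: upt_Suc)
    also have "\<dots> \<le> ennreal (17 / 12 * n + 9)" by (intro ennreal_leI) simp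
    finally show ?thesis .
  qed
  ultimately show ?thesis by blast
qed

end
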